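(* The notion of $(\gamma,\delta)$-similarity has the following properties. 1. For every $0$-asymptotically stable system $\Sigma$ there exists $\gamma>0$ such that, for every $\delta>0$, $\Sigma\preccurlyeq_{\gamma,\delta}\Sigma$. 2. Let $\Sigma_1,\Sigma_2,\Sigma_3$ be $0$-asymptotically stable systems and suppose $\Sigma_1\preccurlyeq_{\gamma_{12},\delta_{12}}\Sigma_2$ and $\Sigma_2\preccurlyeq_{\gamma_{23},\delta_{23}}\Sigma_3$ for some $\gamma_{12},\delta_{12},\gamma_{23},\delta_{23}>0$. Then there exist $\gamma_{13},\delta_{13}>0$ such that $\Sigma_1\preccurlyeq_{\gamma_{13},\delta_{13}}\Sigma_3$.
   Context: A system $\Sigma_i$ is a continuous-time linear system $\dot x_i=A_ix_i+B_iu_i+E_id_i$, $y_i=C_ix_i$ with real constant matrices, state $x_i\in\mathbb{R}^{n_i}$, input $u_i\in\mathbb{R}^{m}$, disturbance $d_i\in\mathbb{R}^{q_i}$ and output $y_i\in\mathbb{R}^{p}$ (systems being compared have the same input dimension and the same output dimension; state and disturbance dimensions may differ). It is $0$-asymptotically stable if $A_i$ is Hurwitz. $y_i(t;t_0,x_{i,0},u_i,d_i)$ denotes the output at time $t$ for initial condition $x_i(t_0)=x_{i,0}$, input $u_i$ and disturbance $d_i$. $\mathcal{L}_2$ is the space of measurable (vector-valued) functions $u$ on $[0,\infty)$ with $\|u\|^2=\int_0^\infty|u(t)|^2\,dt<\infty$, $|\cdot|$ the Euclidean norm. Definition. For $\gamma,\delta>0$ and $0$-asymptotically stable $\Sigma_1,\Sigma_2$,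 the system $\Sigma_2$ is $(\gamma,\delta)$-similar to $\Sigma_1$, written $\Sigma_1\preccurlyeq_{\gamma,\delta}\Sigma_2$, if there exist constants $\varepsilon,\eta,\mu>0$ such that for all $u_1,u_2\in\mathcal{L}_2$ and all $d_1\in\mathcal{L}_2$ there exists $d_2\in\mathcal{L}_2$ with $$\|y_1-y_2\|^2\le\gamma\|u_1-u_2\|^2+(\delta-\varepsilon)\left\|\begin{bmatrix}u_1 \\ u_2\end{bmatrix}\right\|^2+(\mu-\varepsilon)\|d_1\|^2-\eta\|d_2\|^2,$$ where $y_i(t)=y_i(t;0,0,u_i,d_i)$, $i=1,2$. *)

theory Defs
  imports "HOL-Analysis.Analysis"
begin

text \<open>
  The index types \<open>'n\<close>, \<open>'m\<close>, \<open>'q\<close>, \<open>'p\<close> give the dimensions of state, input, disturbance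
  and output.
\<close>

record ('n, 'm, 'q, 'p) linear_system =
  sysA :: "real ^ 'n ^ 'n"
  sysB :: "real ^ 'm ^ 'n"
  sysE :: "real ^ 'q ^ 'n"
  sysC :: "real ^ 'n ^ 'p"

definition eigenvalue :: "complex ^ 'n ^ 'n \<Rightarrow> complex \<Rightarrow> bool" where
  "eigenvalue M z \<longleftrightarrow> (\<exists>v. v \<noteq> 0 \<and> M *v v = z *s v)"

definition hurwitz :: "real ^ 'n ^ 'n \<Rightarrow> bool" where
  "hurwitz A \<longleftrightarrow> (\<forall>z. eigenvalue (map_matrix complex_of_real A) z \<longrightarrow> Re z < 0)"

definition zero_asymptotically_stable ::
  "('n::finite, 'm::finite, 'q::finite, 'p::finite) linear_system \<Rightarrow> bool" where
  "zero_asymptotically_stable S \<longleftrightarrow> hurwitz (sysA S)"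

text \<open>
  Inputs are only measurable, so the differential equation is understood in the sense of
  Caratheodory: \<open>x\<close> is locally absolutely continuous and satisfies the equation almost
  everywhere, i.e. \<open>x\<close> satisfies the integral equation below.
\<close>

definition is_trajectory ::
  "('n::finite, 'm::finite, 'q::finite, 'p::finite) linear_system \<Rightarrow> real \<Rightarrow> real ^ 'n \<Rightarrow>
   (real \<Rightarrow> real ^ 'm) \<Rightarrow> (real \<Rightarrow> real ^ 'q) \<Rightarrow> (real \<Rightarrow> real ^ 'n) \<Rightarrow> bool" where
  "is_trajectory S t0 x0 u d x \<longleftrightarrow>
     (\<forall>t\<ge>t0.
        (\<lambda>s. sysA S *v x s + sysB S *v u s + sysE S *v d s) absolutely_integrable_on {t0..t} \<and>
        x t = x0 + integral {t0..t} (\<lambda>s. sysA S *v x s + sysB S *v u s + sysE S *v d s))"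

text \<open>
  Trajectories are unique on \<open>{t0..}\<close> but arbitrary before \<open>t0\<close>; hence the description
  operator picks the state at a time \<open>t \<ge> t0\<close> rather than the whole function.
\<close>

definition state ::
  "('n::finite, 'm::finite, 'q::finite, 'p::finite) linear_system \<Rightarrow> real \<Rightarrow> real \<Rightarrow> real ^ 'n \<Rightarrow>
   (real \<Rightarrow> real ^ 'm) \<Rightarrow> (real \<Rightarrow> real ^ 'q) \<Rightarrow> real ^ 'n" where
  "state S t t0 x0 u d = (THE z. \<exists>x. is_trajectory S t0 x0 u d x \<and> x t = z)"

definition output_at ::
  "('n::finite, 'm::finite, 'q::finite, 'p::finite) linear_system \<Rightarrow> real \<Rightarrow> real \<Rightarrow> real ^ 'n \<Rightarrow>
   (real \<Rightarrow> real ^ 'm) \<Rightarrow> (real \<Rightarrow> real ^ 'q) \<Rightarrow> real ^ 'p" where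
  "output_at S t t0 x0 u d = sysC S *v state S t t0 x0 u d"

text \<open>
  The squared norm is extended real valued, so that it is infinite (not an arbitrary default
  value) for signals that are not square integrable. Signals are functions on all of
  \<open>real\<close>, but only their values on \<open>{0..}\<close> matter.
\<close>

definition l2_norm_sq :: "(real \<Rightarrow> 'a::euclidean_space) \<Rightarrow> ereal" where
  "l2_norm_sq u = enn2ereal (\<integral>\<^sup>+ t. ennreal ((norm (u t))\<^sup>2) \<partial>lebesgue_on {0..})"

definition L2 :: "(real \<Rightarrow> 'a::euclidean_space) set" where
  "L2 = {u \<in> borel_measurable (lebesgue_on {0..}). l2_norm_sq u < \<infinity>}"

text \<open>
  The product norm satisfies \<open>norm (a, b) = sqrt ((norm a)\<^sup>2 + (norm b)\<^sup>2)\<close>, so the pair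
  \<open>(u1 t, u2 t)\<close> carries the Euclidean norm of the stacked vector. All terms on the right-hand
  side are finite for signals in \<open>L2\<close>.
\<close>

definition similar ::
  "real \<Rightarrow> real \<Rightarrow>
   ('n1::finite, 'm::finite, 'q1::finite, 'p::finite) linear_system \<Rightarrow>
   ('n2::finite, 'm, 'q2::finite, 'p) linear_system \<Rightarrow> bool" where
  "similar \<gamma> \<delta> S1 S2 \<longleftrightarrow>
     (\<exists>\<epsilon>>0. \<exists>\<eta>>0. \<exists>\<mu>>0.
       \<forall>u1\<in>L2. \<forall>u2\<in>L2. \<forall>d1\<in>L2. \<exists>d2\<in>L2.
         l2_norm_sq (\<lambda>t. output_at S1 t 0 0 u1 d1 - output_at S2 t 0 0 u2 d2)
         \<le> ereal \<gamma> * l2_norm_sq (\<lambda>t. u1 t - u2 t)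
           + ereal (\<delta> - \<epsilon>) * l2_norm_sq (\<lambda>t. (u1 t, u2 t))
           + ereal (\<mu> - \<epsilon>) * l2_norm_sq d1
           - ereal \<eta> * l2_norm_sq d2)"

end

theory Submission
  imports
    Defs
    "HOL-Computational_Algebra.Fundamental_Theorem_Algebra"
    "HOL-Real_Asymp.Real_Asymp"
begin

text \<open>
  Both parts rest on one analytic fact (\<open>hurwitz_L2_gain\<close>): if \<open>A\<close> is Hurwitz and \<open>f\<close> is
  square integrable, then \<open>x' = A x + f\<close>, \<open>x(0) = 0\<close>, has a solution on the half-line, and its
  energy (squared L2 norm) is at most a constant times the energy of \<open>f\<close>. Solutions are
  unique (\<open>solves_unique\<close>), so the outputs in the definition of similarity are well defined and
  measurable.

  Reflexivity: answer the disturbance \<open>d\<close> by \<open>d\<close> itself. By linearity the difference of the two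
  outputs is the response to \<open>u1 - u2\<close> alone, so \<open>\<gamma>\<close> can be taken to be the squared L2 gain
  from input to output, independently of \<open>\<delta>\<close>.

  Transitivity: given \<open>u1\<close>, \<open>u3\<close> and \<open>d1\<close>, drive the middle system with \<open>u1\<close>. This yields \<open>d2\<close>,
  and then \<open>d3\<close>. Bound the output difference by the weighted inequality
  \<open>|a + b|\<^sup>2 \<le> (1 + k) |a|\<^sup>2 + (1 + 1/k) |b|\<^sup>2\<close>. The first estimate contributes
  \<open>- (1 + k) \<eta>1 \<parallel>d2\<parallel>\<^sup>2\<close>, and for large \<open>k\<close> this absorbs the term
  \<open>(1 + 1/k) (\<mu>2 - \<epsilon>2) \<parallel>d2\<parallel>\<^sup>2\<close> of the second one.

  The gain estimate avoids the matrix exponential. Over the complex numbers some product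
  \<open>(M - l1) ... (M - lk)\<close> vanishes, where every \<open>li\<close> is an eigenvalue of \<open>M\<close>
  (\<open>ex_annihilating_eigenvalues\<close>). This makes the equation a chain of scalar ones: if \<open>x\<close> solves
  \<open>x' = M x + f\<close>, then \<open>w = (M - l1) x\<close> solves \<open>w' = M w + (M - l1) f\<close>, a problem annihilated by
  the shorter product, and \<open>x' = l1 x + w + f\<close>. Read backwards, this constructs \<open>x\<close> from \<open>w\<close>
  (\<open>shift_ops_L2_gain\<close>). A scalar equation with \<open>Re l < 0\<close> is solved by variation of constants,
  and Cauchy-Schwarz and Tonelli bound its gain by \<open>1 / |Re l|\<close>
  (\<open>scalar_equation_solution\<close>).
\<close>

section \<open>Linear equations with locally integrable forcing\<close>

text \<open>
  \<open>x\<close> solves \<open>x' = M x + f\<close> on \<open>{0..}\<close> with \<open>x 0 = 0\<close>, in the sense of Caratheodory, that is, as an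
  integral equation. The operator \<open>M\<close> is an arbitrary function, so that multiplication by a real or
  complex matrix or by a scalar are all covered. Values at negative times are irrelevant.
\<close>

definition solves :: "('a::euclidean_space \<Rightarrow> 'a) \<Rightarrow> (real \<Rightarrow> 'a) \<Rightarrow> (real \<Rightarrow> 'a) \<Rightarrow> bool" where
  "solves M f x \<longleftrightarrow>
     (\<forall>t\<ge>0. (\<lambda>s. M (x s) + f s) absolutely_integrable_on {0..t} \<and>
             x t = integral {0..t} (\<lambda>s. M (x s) + f s))"

lemma solvesD:
  assumes "solves M f x" "t \<ge> 0"
  shows "(\<lambda>s. M (x s) + f s) absolutely_integrable_on {0..t}"
    and "x t = integral {0..t} (\<lambda>s. M (x s) + f s)"
  using assms unfolding solves_def by blast+

lemma solves_cong:
  assumes "solves M f x" "\<And>t. t \<ge> 0 \<Longrightarrow> x t = y t"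
    and "\<And>t. t \<ge> 0 \<Longrightarrow> M (x t) + f t = N (y t) + g t"
  shows "solves N g y"
  unfolding solves_def
proof (intro allI impI)
  fix t :: real assume t: "t \<ge> 0"
  have "(\<lambda>s. N (y s) + g s) absolutely_integrable_on {0..t}"
    using solvesD(1)[OF assms(1) t]
    by (rule set_integrable_cong[THEN iffD1, rotated -1]) (auto simp: assms(3))
  moreover have "integral {0..t} (\<lambda>s. N (y s) + g s) = integral {0..t} (\<lambda>s. M (x s) + f s)"
    by (rule integral_cong) (auto simp: assms(3))
  ultimately show "(\<lambda>s. N (y s) + g s) absolutely_integrable_on {0..t} \<and>
      y t = integral {0..t} (\<lambda>s. N (y s) + g s)"
    using solvesD(2)[OF assms(1) t] assms(2)[OF t] by simp
qed

lemma solves_linear_image: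
  assumes "solves M f x" "bounded_linear L" "\<And>v. L (M v) = N (L v)"
  shows "solves N (\<lambda>t. L (f t)) (\<lambda>t. L (x t))"
  unfolding solves_def
proof (intro allI impI)
  fix t :: real assume t: "t \<ge> 0"
  have ai: "(\<lambda>s. M (x s) + f s) absolutely_integrable_on {0..t}"
    and xt: "x t = integral {0..t} (\<lambda>s. M (x s) + f s)"
    using solvesD[OF assms(1) t] by blast+
  have eq: "L \<circ> (\<lambda>s. M (x s) + f s) = (\<lambda>s. N (L (x s)) + L (f s))"
    by (auto simp: o_def linear_simps[OF assms(2)] assms(3))
  show "(\<lambda>s. N (L (x s)) + L (f s)) absolutely_integrable_on {0..t} \<and>
    L (x t) = integral {0..t} (\<lambda>s. N (L (x s)) + L (f s))"
    using absolutely_integrable_linear[OF ai assms(2)]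
      integral_linear[OF set_lebesgue_integral_eq_integral(1)[OF ai] assms(2)] xt
    by (simp add: eq)
qed

lemma solves_diff:
  assumes "solves M f x" "solves M g y" "bounded_linear M"
  shows "solves M (\<lambda>t. f t - g t) (\<lambda>t. x t - y t)"
  unfolding solves_def
proof (intro allI impI)
  fix t :: real assume t: "t \<ge> 0"
  have ai: "(\<lambda>s. M (x s) + f s) absolutely_integrable_on {0..t}"
       "(\<lambda>s. M (y s) + g s) absolutely_integrable_on {0..t}"
    and eq: "x t = integral {0..t} (\<lambda>s. M (x s) + f s)" "y t = integral {0..t} (\<lambda>s. M (y s) + g s)"
    using solvesD[OF assms(1) t] solvesD[OF assms(2) t] by blast+
  have *: "(\<lambda>s. M (x s - y s) + (f s - g s)) = (\<lambda>s. (M (x s) + f s) - (M (y s) + g s))"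
    by (auto simp: linear_simps[OF assms(3)])
  show "(\<lambda>s. M (x s - y s) + (f s - g s)) absolutely_integrable_on {0..t} \<and>
    x t - y t = integral {0..t} (\<lambda>s. M (x s - y s) + (f s - g s))"
    unfolding * using set_integral_diff(1)[OF ai]
      integral_diff[OF ai[THEN set_lebesgue_integral_eq_integral(1)]] eq by simp
qed

lemma solves_continuous_on:
  assumes "solves M f x"
  shows "continuous_on {0..T} x"
proof (cases "T \<ge> 0")
  case True
  have "(\<lambda>s. M (x s) + f s) integrable_on {0..T}"
    using assms True set_lebesgue_integral_eq_integral(1) unfolding solves_def by blast
  then have "continuous_on {0..T} (\<lambda>t. integral {0..t} (\<lambda>s. M (x s) + f s))"
    by (rule indefinite_integral_continuous_1)
  then show ?thesis
    by (rule continuous_on_eq) (use solvesD(2)[OF assms] in auto)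
qed auto

lemma solves_borel_measurable:
  assumes "solves M f x"
  shows "x \<in> borel_measurable (lebesgue_on {0..})"
proof (rule continuous_imp_measurable_on_sets_lebesgue)
  show "continuous_on {0..} x"
    unfolding continuous_on_eq_continuous_within
  proof
    fix t :: real assume t: "t \<in> {0..}"
    have "continuous (at t within {0..t+1}) x"
      using solves_continuous_on[OF assms, of "t+1"] t by (auto simp: continuous_on_eq_continuous_within)
    moreover have "at t within {0..t+1} = at t within {0..}"
      by (rule at_within_nhd[of _ "{t-1<..<t+1}"]) auto
    ultimately show "continuous (at t within {0..}) x"
      by (simp add: continuous_within)
  qed
qed auto

lemma solves_homogeneous:
  assumes "solves M (\<lambda>_. 0) x" and M: "bounded_linear M" and "t \<ge> 0"
  shows "x t = 0"
proof (cases "t = 0")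
  case True then show ?thesis using assms(1) by (simp add: solves_def)
next
  case False
  then have t: "t > 0" using assms by simp
  obtain K where K: "\<And>v. norm (M v) \<le> norm v * K"
    using bounded_linear.bounded[OF M] by blast
  have cx: "continuous_on {0..t} x" using solves_continuous_on[OF assms(1)] .
  have cM: "continuous_on {0..t} (\<lambda>s. M (x s))"
    using cx M bounded_linear.continuous_on by blast
  have x_eq: "x s = integral {0..s} (\<lambda>s. M (x s))" if "s \<ge> 0" for s
    using solvesD(2)[OF assms(1) that] by simp
  \<comment> \<open>A homogeneous solution is continuously differentiable, and \<open>K\<close> bounds the growth of its norm.\<close>
  define \<phi> where "\<phi> s = exp (-2 * K * s) * (x s \<bullet> x s)" for s
  have "\<phi> t \<le> \<phi> 0"
  proof (rule DERIV_nonpos_imp_decreasing_open[where f = \<phi> and a = 0 and b = t])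
    show "continuous_on {0..t} \<phi>" unfolding \<phi>_def by (intro continuous_intros cx)
    fix s :: real assume s: "0 < s" "s < t"
    have "((\<lambda>u. integral {0..u} (\<lambda>s. M (x s))) has_vector_derivative M (x s)) (at s within {0..t})"
      using s by (intro integral_has_vector_derivative[OF cM]) auto
    then have "(x has_vector_derivative M (x s)) (at s within {0..t})"
      by (rule has_vector_derivative_transform[rotated 2]) (use s x_eq in auto)
    then have d: "(x has_vector_derivative M (x s)) (at s)"
      using s by (simp add: at_within_Icc_at)
    then have d': "(x has_derivative (\<lambda>h. h *\<^sub>R M (x s))) (at s)"
      by (simp add: has_vector_derivative_def)
    have "((\<lambda>s. x s \<bullet> x s) has_real_derivative 2 * (x s \<bullet> M (x s))) (at s)"
      unfolding has_field_derivative_def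
      by (rule has_derivative_eq_rhs[OF has_derivative_inner[OF d' d']])
         (auto simp: inner_commute algebra_simps)
    then have D: "(\<phi> has_real_derivative
        exp (-2*K * s) * (2 * (x s \<bullet> M (x s))) - 2 * K * exp (-2*K * s) * (x s \<bullet> x s)) (at s)"
      unfolding \<phi>_def by (auto intro!: derivative_eq_intros simp: algebra_simps)
    have "x s \<bullet> M (x s) \<le> norm (x s) * norm (M (x s))" by (rule norm_cauchy_schwarz)
    also have "\<dots> \<le> norm (x s) * (norm (x s) * K)" by (intro mult_left_mono K) auto
    also have "\<dots> = K * (x s \<bullet> x s)" by (simp add: power2_norm_eq_inner[symmetric] power2_eq_square)
    finally have "exp (-2*K * s) * (2 * (x s \<bullet> M (x s))) \<le> exp (-2*K * s) * (2 * (K * (x s \<bullet> x s)))"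
      by simp
    then show "\<exists>y. (\<phi> has_real_derivative y) (at s) \<and> y \<le> 0"
      by (intro exI conjI) (rule D, simp add: algebra_simps)
  qed (use t in auto)
  moreover have "\<phi> 0 = 0" using x_eq[of 0] by (simp add: \<phi>_def)
  ultimately have "x t \<bullet> x t \<le> 0" by (simp add: \<phi>_def mult_le_0_iff)
  then show ?thesis by (metis inner_gt_zero_iff linorder_not_less)
qed

lemma solves_unique:
  assumes "solves M f x" "solves M f y" "bounded_linear M" "t \<ge> 0"
  shows "x t = y t"
proof -
  have "solves M (\<lambda>t. f t - f t) (\<lambda>t. x t - y t)"
    by (rule solves_diff) fact+
  then show ?thesis using solves_homogeneous[OF _ assms(3,4), of "\<lambda>t. x t - y t"] by simp
qed

section \<open>Square integrable signals\<close>

text \<open>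
  The squared L2 norm on the half-line, with values in the extended nonnegative reals, where
  integrals and constants are multiplied without side conditions. It is the same quantity as
  \<open>l2_norm_sq\<close>, which takes values in \<open>ereal\<close>.
\<close>

definition energy :: "(real \<Rightarrow> 'a::euclidean_space) \<Rightarrow> ennreal" where
  "energy u = (\<integral>\<^sup>+ t. ennreal ((norm (u t))\<^sup>2) \<partial>lebesgue_on {0..})"

lemma L2_iff: "u \<in> L2 \<longleftrightarrow> u \<in> borel_measurable (lebesgue_on {0..}) \<and> energy u < \<infinity>"
  by (simp add: L2_def l2_norm_sq_def energy_def less_ennreal.rep_eq)

lemma energy_cong: "(\<And>t. t \<ge> 0 \<Longrightarrow> u t = v t) \<Longrightarrow> energy u = energy v"
  unfolding energy_def by (rule nn_integral_cong) auto

lemma energy_mono_scaled: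
  assumes "v \<in> borel_measurable (lebesgue_on {0..})" "\<And>t. t \<ge> 0 \<Longrightarrow> norm (u t) \<le> K * norm (v t)"
  shows "energy u \<le> ennreal (K\<^sup>2) * energy v"
proof -
  have "energy u \<le> (\<integral>\<^sup>+ t. ennreal (K\<^sup>2) * ennreal ((norm (v t))\<^sup>2) \<partial>lebesgue_on {0..})"
    unfolding energy_def
  proof (rule nn_integral_mono)
    fix t :: real assume "t \<in> space (lebesgue_on {0..})"
    then have "(norm (u t))\<^sup>2 \<le> (K * norm (v t))\<^sup>2"
      by (intro power_mono assms(2)) auto
    then show "ennreal ((norm (u t))\<^sup>2) \<le> ennreal (K\<^sup>2) * ennreal ((norm (v t))\<^sup>2)"
      by (simp add: ennreal_mult[symmetric] power_mult_distrib)
  qed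
  also have "\<dots> = ennreal (K\<^sup>2) * energy v"
    unfolding energy_def using assms(1) by (intro nn_integral_cmult) measurable
  finally show ?thesis .
qed

text \<open>
  The free weight \<open>k\<close> is what makes the disturbance of the middle system disappear in the proof of
  transitivity.
\<close>

lemma energy_add_le:
  assumes "u \<in> borel_measurable (lebesgue_on {0..})" "v \<in> borel_measurable (lebesgue_on {0..})" "k > 0"
  shows "energy (\<lambda>t. u t + v t) \<le> ennreal (1 + k) * energy u + ennreal (1 + 1/k) * energy v"
proof -
  have ineq: "(norm (a + b))\<^sup>2 \<le> (1 + k) * (norm a)\<^sup>2 + (1 + 1/k) * (norm b)\<^sup>2" for a b :: 'a
  proof -
    have "(norm (a + b))\<^sup>2 \<le> (norm a + norm b)\<^sup>2"
      by (intro power_mono norm_triangle_ineq) auto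
    also have "\<dots> = (norm a)\<^sup>2 + 2 * norm a * norm b + (norm b)\<^sup>2"
      by (simp add: power2_sum)
    also have "2 * norm a * norm b \<le> k * (norm a)\<^sup>2 + (1/k) * (norm b)\<^sup>2"
    proof -
      have "0 \<le> (k * norm a - norm b)\<^sup>2 / k" using assms(3) by simp
      also have "\<dots> = (k\<^sup>2 * (norm a)\<^sup>2 - 2 * (k * norm a) * norm b + (norm b)\<^sup>2) / k"
        by (simp add: power2_diff power_mult_distrib)
      also have "\<dots> = k * (norm a)\<^sup>2 - 2 * norm a * norm b + (1/k) * (norm b)\<^sup>2"
        using assms(3) by (simp add: add_divide_distrib diff_divide_distrib power2_eq_square[of k])
      finally show ?thesis by simp
    qed
    finally show ?thesis by (simp add: distrib_right)
  qed
  have "energy (\<lambda>t. u t + v t) \<le> (\<integral>\<^sup>+ t. ennreal (1 + k) * ennreal ((norm (u t))\<^sup>2)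
      + ennreal (1 + 1/k) * ennreal ((norm (v t))\<^sup>2) \<partial>lebesgue_on {0..})"
    unfolding energy_def
  proof (rule nn_integral_mono)
    fix t
    show "ennreal ((norm (u t + v t))\<^sup>2) \<le> ennreal (1 + k) * ennreal ((norm (u t))\<^sup>2)
      + ennreal (1 + 1/k) * ennreal ((norm (v t))\<^sup>2)"
      using ineq[of "u t" "v t"] assms(3)
      by (simp add: ennreal_mult[symmetric] ennreal_plus[symmetric] del: ennreal_plus)
  qed
  also have "\<dots> = ennreal (1 + k) * energy u + ennreal (1 + 1/k) * energy v"
    unfolding energy_def using assms(1,2)
    by (subst nn_integral_add) (auto simp: nn_integral_cmult)
  finally show ?thesis .
qed

lemma L2_dominated:
  assumes "v \<in> L2" "u \<in> borel_measurable (lebesgue_on {0..})" "\<And>t. t \<ge> 0 \<Longrightarrow> norm (u t) \<le> K * norm (v t)"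
  shows "u \<in> L2"
proof -
  have "energy u \<le> ennreal (K\<^sup>2) * energy v"
    by (rule energy_mono_scaled) (use assms in \<open>simp_all add: L2_iff\<close>)
  also have "\<dots> < \<infinity>" using assms(1) by (simp add: L2_iff ennreal_mult_less_top)
  finally show ?thesis using assms(2) by (simp add: L2_iff)
qed

lemma L2_linear:
  assumes "v \<in> L2" "bounded_linear L"
  shows "(\<lambda>t. L (v t)) \<in> L2"
proof -
  obtain K where K: "\<And>x. norm (L x) \<le> norm x * K"
    using bounded_linear.bounded[OF assms(2)] by blast
  have "L \<in> borel_measurable borel"
    using assms(2) by (intro borel_measurable_continuous_onI linear_continuous_on)
  then have m: "(\<lambda>t. L (v t)) \<in> borel_measurable (lebesgue_on {0..})"
    by (rule measurable_compose[rotated]) (use assms(1) in \<open>simp add: L2_iff\<close>)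
  show ?thesis
    by (rule L2_dominated[OF assms(1) m, of K]) (use K in \<open>simp only: mult.commute\<close>)
qed

lemma L2_add: "u \<in> L2 \<Longrightarrow> v \<in> L2 \<Longrightarrow> (\<lambda>t. u t + v t) \<in> L2"
  using le_less_trans[OF energy_add_le[of u v 1], of \<infinity>]
  by (simp add: L2_iff ennreal_mult_less_top borel_measurable_add)

lemma L2_diff: "u \<in> L2 \<Longrightarrow> v \<in> L2 \<Longrightarrow> (\<lambda>t. u t - v t) \<in> L2"
  using L2_add[of u "\<lambda>t. - v t"] L2_linear[of v uminus] by (simp add: bounded_linear_minus)

lemma L2_absolutely_integrable:
  assumes "u \<in> L2"
  shows "u absolutely_integrable_on {0..t}"
proof -
  have m: "u \<in> borel_measurable (lebesgue_on {0..t})"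
    using assms by (auto simp: L2_iff intro: measurable_restrict_mono)
  have "integrable (lebesgue_on {0..t}) u"
  proof (rule integrableI_bounded[OF m])
    have "(\<integral>\<^sup>+ s. ennreal (norm (u s)) \<partial>lebesgue_on {0..t}) \<le>
          (\<integral>\<^sup>+ s. 1 + ennreal ((norm (u s))\<^sup>2) \<partial>lebesgue_on {0..t})"
    proof (rule nn_integral_mono)
      fix s
      have "0 \<le> (norm (u s) - 1)\<^sup>2 + (norm (u s))\<^sup>2 + 1" by simp
      then have "norm (u s) \<le> 1 + (norm (u s))\<^sup>2"
        by (simp add: power2_diff)
      then show "ennreal (norm (u s)) \<le> 1 + ennreal ((norm (u s))\<^sup>2)"
        by (simp add: ennreal_1[symmetric] ennreal_plus[symmetric] del: ennreal_1 ennreal_plus)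
    qed
    also have "\<dots> = emeasure lebesgue {0..t} + (\<integral>\<^sup>+ s. ennreal ((norm (u s))\<^sup>2) \<partial>lebesgue_on {0..t})"
      using m by (subst nn_integral_add) (auto simp: emeasure_restrict_space)
    also have "\<dots> \<le> emeasure lebesgue {0..t} + energy u"
      unfolding energy_def
      by (subst (1 2) nn_integral_restrict_space)
         (auto intro!: add_left_mono nn_integral_mono simp: indicator_def)
    also have "\<dots> < \<infinity>"
      using assms by (cases "0 \<le> t") (auto simp: L2_iff)
    finally show "(\<integral>\<^sup>+ s. ennreal (norm (u s)) \<partial>lebesgue_on {0..t}) < \<infinity>" .
  qed
  then show ?thesis by (simp add: integrable_restrict_space set_integrable_def)
qed

section \<open>Scalar equations: solution formula\<close>

lemma norm_vector_scalar_mult: "norm (c *s (v :: complex ^ 'n)) = cmod c * norm v"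
  by (simp add: norm_vec_def norm_mult L2_set_right_distrib)

lemma bounded_bilinear_vector_scalar_mult:
  "bounded_bilinear (\<lambda>(c::complex) (v :: complex ^ 'n). c *s v)"
proof
  show "\<exists>K. \<forall>(a::complex) (b :: complex ^ 'n). norm (a *s b) \<le> norm a * norm b * K"
    by (rule exI[of _ 1]) (simp add: norm_vector_scalar_mult)
qed (simp_all add: vec_eq_iff algebra_simps)

lemmas bounded_linear_vector_scalar_mult =
  bounded_bilinear.bounded_linear_right[OF bounded_bilinear_vector_scalar_mult]
lemmas bounded_linear_vector_scalar_mult_left =
  bounded_bilinear.bounded_linear_left[OF bounded_bilinear_vector_scalar_mult]
lemmas continuous_on_vector_scalar_mult =
  bounded_bilinear.continuous_on[OF bounded_bilinear_vector_scalar_mult]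

lemma borel_measurable_vector_scalar_mult:
  fixes f :: "'a \<Rightarrow> complex" and g :: "'a \<Rightarrow> complex ^ 'n"
  assumes "f \<in> borel_measurable M" "g \<in> borel_measurable M"
  shows "(\<lambda>x. f x *s g x) \<in> borel_measurable M"
  by (rule borel_measurable_continuous_Pair[OF assms])
     (intro continuous_on_vector_scalar_mult continuous_intros)

text \<open>
  Integration by parts of \<open>\<phi>\<close> against the indefinite integral of a merely integrable \<open>h\<close>. That
  integral need not be differentiable off a countable set, so the formula is derived from Fubini's
  theorem on the triangle \<open>r \<le> s\<close> instead of the fundamental theorem of calculus.
\<close>

lemma integral_by_parts_indefinite_integral:
  fixes \<phi> \<phi>' :: "real \<Rightarrow> complex" and h :: "real \<Rightarrow> complex ^ 'n"
  assumes h: "h absolutely_integrable_on {0..t}" and t: "t \<ge> 0"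
    and d: "\<And>s. (\<phi> has_vector_derivative \<phi>' s) (at s)" and c: "continuous_on UNIV \<phi>'"
  shows "(\<lambda>s. \<phi>' s *s integral {0..s} h) absolutely_integrable_on {0..t}"
    and "(\<lambda>s. \<phi> s *s h s) absolutely_integrable_on {0..t}"
    and "integral {0..t} (\<lambda>s. \<phi>' s *s integral {0..s} h)
       = \<phi> t *s integral {0..t} h - integral {0..t} (\<lambda>s. \<phi> s *s h s)"
proof -
  define N where "N = lebesgue_on {0..t}"
  interpret N: finite_measure N unfolding N_def by (rule finite_measure_lebesgue_on) simp
  interpret NN: pair_sigma_finite N N ..
  have spN [simp]: "space N = {0..t}" by (simp add: N_def)
  have h_int: "integrable N h" using h by (simp add: N_def integrable_restrict_space set_integrable_def)
  have h_meas: "h \<in> borel_measurable N" using h_int by simp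
  have h_ion: "h integrable_on {0..s}" if "s \<in> {0..t}" for s
    using set_lebesgue_integral_eq_integral(1)[OF h] integrable_on_subinterval[of h "{0..t}" 0 s] that by auto
  have c\<phi>: "continuous_on S \<phi>" for S
    using d by (meson continuous_at_imp_continuous_on has_vector_derivative_continuous)
  have c': "continuous_on S \<phi>'" for S using c continuous_on_subset by blast
  obtain K where K: "\<And>s. s \<in> {0..t} \<Longrightarrow> cmod (\<phi>' s) \<le> K"
    using compact_imp_bounded[OF compact_continuous_image[OF c' compact_Icc[of 0 t]]]
    unfolding bounded_iff by fastforce
  have cG: "continuous_on {0..t} (\<lambda>s. \<phi>' s *s integral {0..s} h)"
    by (intro continuous_on_vector_scalar_mult c' indefinite_integral_continuous_1 h_ion) (use t in auto)
  then show a1: "(\<lambda>s. \<phi>' s *s integral {0..s} h) absolutely_integrable_on {0..t}"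
    by (rule absolutely_integrable_continuous_real)
  have prod: "(\<lambda>s. \<psi> s *s h s) absolutely_integrable_on {0..t}" if "continuous_on {0..t} \<psi>" for \<psi> :: "real \<Rightarrow> complex"
  proof -
    have "bilinear (\<lambda>(c::complex) (v :: complex ^ 'n). c *s v)"
      by (simp add: bilinear_conv_bounded_bilinear bounded_bilinear_vector_scalar_mult)
    moreover have "\<psi> \<in> borel_measurable (lebesgue_on {0..t})"
      using that by (rule continuous_imp_measurable_on_sets_lebesgue) simp
    moreover have "bounded (\<psi> ` {0..t})"
      by (rule compact_imp_bounded[OF compact_continuous_image[OF that compact_Icc]])
    ultimately show ?thesis
      using absolutely_integrable_bounded_measurable_product[OF _ _ _ _ h] by simp
  qed
  show a2: "(\<lambda>s. \<phi> s *s h s) absolutely_integrable_on {0..t}" by (rule prod[OF c\<phi>])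
  have a3: "(\<lambda>s. (\<phi> t - \<phi> s) *s h s) absolutely_integrable_on {0..t}"
    by (rule prod) (intro continuous_intros c\<phi>)
  have toN: "integrable N f \<longleftrightarrow> f absolutely_integrable_on {0..t}" for f :: "real \<Rightarrow> complex ^ 'n"
    by (simp add: N_def integrable_restrict_space set_integrable_def)
  have LN: "integral\<^sup>L N f = integral {0..t} f" if "integrable N f" for f :: "real \<Rightarrow> complex ^ 'n"
    using lebesgue_integral_eq_integral[of "{0..t}" f] that by (simp add: N_def)

  define F where "F r s = (if r \<le> s then \<phi>' s else 0) *s h r" for r s
  have F_meas: "case_prod F \<in> borel_measurable (N \<Otimes>\<^sub>M N)"
  proof -
    have id: "(\<lambda>x. x) \<in> borel_measurable N"
      unfolding N_def by (intro continuous_imp_measurable_on_sets_lebesgue continuous_intros) auto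
    have f: "fst \<in> borel_measurable (N \<Otimes>\<^sub>M N)" and s: "snd \<in> borel_measurable (N \<Otimes>\<^sub>M N)"
      by (rule measurable_compose[OF measurable_fst id], rule measurable_compose[OF measurable_snd id])
    have "(\<lambda>p. \<phi>' (snd p)) \<in> borel_measurable (N \<Otimes>\<^sub>M N)"
      by (rule measurable_compose[OF s borel_measurable_continuous_onI[OF c]])
    then have "(\<lambda>p. if fst p \<le> snd p then \<phi>' (snd p) else 0) \<in> borel_measurable (N \<Otimes>\<^sub>M N)"
      using f s by (intro measurable_If borel_measurable_le borel_measurable_const) auto
    from borel_measurable_vector_scalar_mult[OF this measurable_compose[OF measurable_fst h_meas]]
    show ?thesis by (simp add: F_def case_prod_beta')
  qed
  have F_bound: "norm (F r s) \<le> K * norm (h r)" if "s \<in> {0..t}" for r s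
    using K[OF that] order_trans[OF norm_ge_zero K[OF that]]
    by (auto simp: F_def norm_vector_scalar_mult intro!: mult_right_mono)
  have F_int: "integrable (N \<Otimes>\<^sub>M N) (case_prod F)"
  proof (rule integrableI_bounded[OF F_meas])
    have "(\<integral>\<^sup>+ p. ennreal (norm (case_prod F p)) \<partial>(N \<Otimes>\<^sub>M N))
        = (\<integral>\<^sup>+ r. \<integral>\<^sup>+ s. ennreal (norm (F r s)) \<partial>N \<partial>N)"
      using F_meas by (subst N.nn_integral_fst[symmetric]) auto
    also have "\<dots> \<le> (\<integral>\<^sup>+ r. \<integral>\<^sup>+ s. ennreal (norm (K *\<^sub>R h r)) \<partial>N \<partial>N)"
    proof (intro nn_integral_mono ennreal_leI)
      fix r s assume "s \<in> space N"
      then show "norm (F r s) \<le> norm (K *\<^sub>R h r)"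
        using F_bound[of s r] order_trans[OF norm_ge_zero K, of s] by simp
    qed
    also have "\<dots> = (\<integral>\<^sup>+ r. ennreal (norm (K *\<^sub>R h r)) \<partial>N) * emeasure N (space N)"
      using h_meas by (simp add: nn_integral_multc)
    also have "\<dots> < top"
    proof (rule ennreal_mult_less_top[THEN iffD2], intro disjI2 conjI)
      show "(\<integral>\<^sup>+ r. ennreal (norm (K *\<^sub>R h r)) \<partial>N) < top"
        using integrable_scaleR_right[OF h_int, of K] by (simp add: integrable_iff_bounded)
      show "emeasure N (space N) < top"
        using N.emeasure_finite[of "space N"] top.not_eq_extremum by fastforce
    qed
    finally show "(\<integral>\<^sup>+ p. ennreal (norm (case_prod F p)) \<partial>(N \<Otimes>\<^sub>M N)) < \<infinity>" by simp
  qed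
  have inner_r: "(\<integral>r. F r s \<partial>N) = \<phi>' s *s integral {0..s} h" if s: "s \<in> {0..t}" for s
  proof -
    have "integrable N (\<lambda>r. F r s)"
    proof (rule Bochner_Integration.integrable_bound[OF integrable_scaleR_right[OF h_int, of K]])
      show "(\<lambda>r. F r s) \<in> borel_measurable N"
        using measurable_compose[OF measurable_Pair2'[of s N N] F_meas] s by simp
      show "AE r in N. norm (F r s) \<le> norm (K *\<^sub>R h r)"
        using F_bound[OF s] order_trans[OF norm_ge_zero K[OF s]] by simp
    qed
    then have "(\<integral>r. F r s \<partial>N) = integral {0..t} (\<lambda>r. F r s)" by (rule LN)
    also have "\<dots> = integral {0..t} (\<lambda>r. if r \<in> {0..s} then \<phi>' s *s h r else 0)"
      by (rule integral_cong) (auto simp: F_def)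
    also have "\<dots> = \<phi>' s *s integral {0..s} h"
    proof (rule integral_unique, subst has_integral_restrict)
      show "((\<lambda>r. \<phi>' s *s h r) has_integral \<phi>' s *s integral {0..s} h) {0..s}"
        using has_integral_linear[OF integrable_integral[OF h_ion[OF s]]
            bounded_linear_vector_scalar_mult[of "\<phi>' s"]]
        by (simp add: o_def)
    qed (use s in auto)
    finally show ?thesis .
  qed
  have inner_s: "(\<integral>s. F r s \<partial>N) = (\<phi> t - \<phi> r) *s h r" if r: "r \<in> {0..t}" for r
  proof -
    have "integrable N (\<lambda>s. F r s)"
    proof (rule Bochner_Integration.integrable_bound[OF N.integrable_const[of "K * norm (h r)"]])
      show "(\<lambda>s. F r s) \<in> borel_measurable N"
        using measurable_compose[OF measurable_Pair1'[of r N N] F_meas] r by simp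
      show "AE s in N. norm (F r s) \<le> norm (K * norm (h r))"
      proof (rule AE_I2)
        fix s assume "s \<in> space N"
        then have "norm (F r s) \<le> K * norm (h r)" by (intro F_bound) simp
        also have "\<dots> \<le> norm (K * norm (h r))" unfolding real_norm_def by (rule abs_ge_self)
        finally show "norm (F r s) \<le> norm (K * norm (h r))" .
      qed
    qed
    then have "(\<integral>s. F r s \<partial>N) = integral {0..t} (\<lambda>s. F r s)" by (rule LN)
    also have "\<dots> = integral {0..t} (\<lambda>s. if s \<in> {r..t} then \<phi>' s *s h r else 0)"
      by (rule integral_cong) (auto simp: F_def)
    also have "\<dots> = (\<phi> t - \<phi> r) *s h r"
    proof (rule integral_unique, subst has_integral_restrict)
      have "(\<phi>' has_integral (\<phi> t - \<phi> r)) {r..t}"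
        using r d by (intro fundamental_theorem_of_calculus) (auto intro: has_vector_derivative_at_within)
      from has_integral_linear[OF this bounded_linear_vector_scalar_mult_left[of "h r"]]
      show "((\<lambda>s. \<phi>' s *s h r) has_integral (\<phi> t - \<phi> r) *s h r) {r..t}" by (simp add: o_def)
    qed (use r in auto)
    finally show ?thesis .
  qed
  have "integral {0..t} (\<lambda>s. \<phi>' s *s integral {0..s} h) = (\<integral>s. \<phi>' s *s integral {0..s} h \<partial>N)"
    using a1 toN LN by simp
  also have "\<dots> = (\<integral>s. (\<integral>r. F r s \<partial>N) \<partial>N)"
    by (rule Bochner_Integration.integral_cong) (simp_all add: inner_r)
  also have "\<dots> = (\<integral>r. (\<integral>s. F r s \<partial>N) \<partial>N)"
    by (rule NN.Fubini_integral[OF F_int])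
  also have "\<dots> = (\<integral>r. (\<phi> t - \<phi> r) *s h r \<partial>N)"
    by (rule Bochner_Integration.integral_cong) (simp_all add: inner_s)
  also have "\<dots> = integral {0..t} (\<lambda>r. (\<phi> t - \<phi> r) *s h r)"
    using a3 toN LN by simp
  also have "\<dots> = integral {0..t} (\<lambda>r. \<phi> t *s h r - \<phi> r *s h r)"
    by (rule integral_cong) (simp add: vec.scale_left_diff_distrib)
  also have "\<dots> = integral {0..t} (\<lambda>r. \<phi> t *s h r) - integral {0..t} (\<lambda>r. \<phi> r *s h r)"
    using a2 prod[of "\<lambda>_. \<phi> t"]
    by (intro integral_diff set_lebesgue_integral_eq_integral(1)) simp_all
  also have "integral {0..t} (\<lambda>r. \<phi> t *s h r) = \<phi> t *s integral {0..t} h"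
    using integral_linear[OF h_ion bounded_linear_vector_scalar_mult[of "\<phi> t"], of t] t by (simp add: o_def)
  finally show "integral {0..t} (\<lambda>s. \<phi>' s *s integral {0..s} h)
       = \<phi> t *s integral {0..t} h - integral {0..t} (\<lambda>s. \<phi> s *s h s)" .
qed

section \<open>Scalar equations: the L2 gain\<close>

lemma sigma_finite_measure_completion:
  assumes "sigma_finite_measure M"
  shows "sigma_finite_measure (completion M)"
proof -
  from assms obtain A where A: "countable A" "A \<subseteq> sets M" "\<Union>A = space M" "\<forall>a\<in>A. emeasure M a \<noteq> \<infinity>"
    unfolding sigma_finite_measure_def by blast
  have A': "a \<in> sets (completion M)" "emeasure (completion M) a \<noteq> \<infinity>" if "a \<in> A" for a
  proof -
    have a: "a \<in> sets M" using that A(2) by blast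
    then show "a \<in> sets (completion M)" by (rule sets_completionI_sets)
    show "emeasure (completion M) a \<noteq> \<infinity>" using a A(4) that by (simp add: main_part_sets)
  qed
  show ?thesis
    unfolding sigma_finite_measure_def
    by (rule exI[of _ A]) (use A(1,3) A' in \<open>simp add: subset_iff\<close>)
qed

lemma sigma_finite_lebesgue_on:
  "S \<in> sets lebesgue \<Longrightarrow> sigma_finite_measure (lebesgue_on (S :: 'a::euclidean_space set))"
  by (intro sigma_finite_measure_restrict_space sigma_finite_measure_completion sigma_finite_lborel)

text \<open>
  The two marginal integrals of the kernel \<open>exp (- a (t - s))\<close> on \<open>0 \<le> s \<le> t\<close>.
\<close>

lemma nn_integral_exp_kernel_past:
  assumes "a > 0"
  shows "(\<integral>\<^sup>+ s. ennreal (if s \<le> t then exp (- (a * (t - s))) else 0) \<partial>lebesgue_on {0..}) \<le> ennreal (1 / a)"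
proof (cases "t \<ge> 0")
  case True
  have "(\<integral>\<^sup>+ s. ennreal (if s \<le> t then exp (- (a * (t - s))) else 0) \<partial>lebesgue_on {0..})
      = (\<integral>\<^sup>+ s. ennreal (exp (- (a * (t - s)))) * indicator {0..t} s \<partial>lborel)"
    by (subst nn_integral_restrict_space)
       (auto simp: nn_integral_completion indicator_def intro!: nn_integral_cong)
  also have "\<dots> = ennreal (exp (- (a * (t - t))) / a - exp (- (a * (t - 0))) / a)"
  proof (rule nn_integral_FTC_Icc[where F = "\<lambda>s. exp (- (a * (t - s))) / a"])
    fix s show "((\<lambda>s. exp (- (a * (t - s))) / a) has_real_derivative exp (- (a * (t - s)))) (at s)"
      using assms by (auto intro!: derivative_eq_intros)
  qed (use True in auto)
  also have "\<dots> \<le> ennreal (1 / a)" using assms by (intro ennreal_leI) simp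
  finally show ?thesis .
next
  case False
  have "(\<integral>\<^sup>+ s. ennreal (if s \<le> t then exp (- (a * (t - s))) else 0) \<partial>lebesgue_on {0..})
      = (\<integral>\<^sup>+ s. 0 \<partial>lebesgue_on {0::real..})"
    using False by (intro nn_integral_cong) auto
  then show ?thesis by simp
qed

lemma nn_integral_exp_kernel_future:
  assumes "a > 0" "s \<ge> 0"
  shows "(\<integral>\<^sup>+ t. ennreal (if s \<le> t then exp (- (a * (t - s))) else 0) \<partial>lebesgue_on {0..}) = ennreal (1 / a)"
proof -
  have "(\<integral>\<^sup>+ t. ennreal (if s \<le> t then exp (- (a * (t - s))) else 0) \<partial>lebesgue_on {0..})
      = (\<integral>\<^sup>+ t. ennreal (exp (- (a * (t - s)))) * indicator {s..} t \<partial>lborel)"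
    using assms(2) by (subst nn_integral_restrict_space)
       (auto simp: nn_integral_completion indicator_def intro!: nn_integral_cong)
  also have "\<dots> = ennreal (0 - (- exp (- (a * (s - s))) / a))"
  proof (rule nn_integral_FTC_atLeast[where F = "\<lambda>t. - exp (- (a * (t - s))) / a"])
    fix t show "((\<lambda>t. - exp (- (a * (t - s))) / a) has_real_derivative exp (- (a * (t - s)))) (at t)"
      using assms by (auto intro!: derivative_eq_intros)
    show "((\<lambda>t. - exp (- (a * (t - s))) / a) \<longlongrightarrow> 0) at_top"
      using assms(1) by real_asymp
  qed auto
  finally show ?thesis by simp
qed

text \<open>
  Young's inequality for convolution with \<open>exp (- a t)\<close>, whose L1 norm is \<open>1 / a\<close>. Only a pointwise
  bound of \<open>x\<close> by the convolution is needed. The square root \<open>r\<close> of the kernel splits the integrand for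
  the Cauchy-Schwarz inequality.
\<close>

lemma energy_exp_convolution_le:
  assumes g: "g \<in> borel_measurable (lebesgue_on {0..})" and a: "a > 0"
    and x: "\<And>t. t \<ge> 0 \<Longrightarrow> ennreal (norm (x t)) \<le>
      (\<integral>\<^sup>+ s. ennreal ((if s \<le> t then exp (- (a * (t - s))) else 0) * norm (g s)) \<partial>lebesgue_on {0..})"
  shows "energy x \<le> ennreal (1 / a\<^sup>2) * energy g"
proof -
  define M where "M = lebesgue_on {0::real..}"
  define k where "k t s = (if s \<le> t then exp (- (a * (t - s))) else 0)" for t s :: real
  define r where "r t s = (if s \<le> t then exp (- (a * (t - s)) / 2) else 0)" for t s :: real
  have r_sq: "(r t s)\<^sup>2 = k t s" and r_nonneg: "r t s \<ge> 0" and k_nonneg: "k t s \<ge> 0" for t s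
    by (auto simp: r_def k_def exp_double[symmetric] power2_eq_square mult_exp_exp)
  interpret M: sigma_finite_measure M
    unfolding M_def by (rule sigma_finite_lebesgue_on) simp
  interpret MM: pair_sigma_finite M M ..
  have id: "(\<lambda>x. x) \<in> borel_measurable M"
    unfolding M_def by (intro continuous_imp_measurable_on_sets_lebesgue continuous_intros) auto
  have gM [measurable]: "g \<in> borel_measurable M" using g by (simp add: M_def)
  have r_meas [measurable]: "r t \<in> borel_measurable M" for t
    by (rule measurable_compose[OF id]) (simp add: r_def)
  have f [measurable]: "fst \<in> borel_measurable (M \<Otimes>\<^sub>M M)" 
    and s [measurable]: "snd \<in> borel_measurable (M \<Otimes>\<^sub>M M)"
    by (rule measurable_compose[OF measurable_fst id], rule measurable_compose[OF measurable_snd id])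
  have k_meas [measurable]: "k t \<in> borel_measurable M" for t
    by (rule measurable_compose[OF id]) (simp add: k_def)
  have kk_meas: "(\<lambda>p. k (fst p) (snd p)) \<in> borel_measurable (M \<Otimes>\<^sub>M M)"
    unfolding k_def by (intro measurable_If borel_measurable_le borel_measurable_const
      borel_measurable_exp borel_measurable_uminus borel_measurable_times borel_measurable_diff f s) auto
  have pointwise: "ennreal ((norm (x t))\<^sup>2) \<le> ennreal (1 / a) * (\<integral>\<^sup>+ s. ennreal (k t s * (norm (g s))\<^sup>2) \<partial>M)"
    if "t \<ge> 0" for t
  proof -
    have "ennreal ((norm (x t))\<^sup>2) = (ennreal (norm (x t)))\<^sup>2" by (simp add: ennreal_power)
    also have "\<dots> \<le> (\<integral>\<^sup>+ s. ennreal (k t s * norm (g s)) \<partial>M)\<^sup>2"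
      using x[OF that] by (intro power_mono) (simp_all add: M_def k_def)
    also have "(\<integral>\<^sup>+ s. ennreal (k t s * norm (g s)) \<partial>M)
        = (\<integral>\<^sup>+ s. ennreal (r t s) * ennreal (r t s * norm (g s)) \<partial>M)"
      by (intro nn_integral_cong)
         (simp add: ennreal_mult[symmetric] r_nonneg r_sq[symmetric] power2_eq_square mult.assoc)
    also have "\<dots>\<^sup>2 \<le> (\<integral>\<^sup>+ s. (ennreal (r t s))\<^sup>2 \<partial>M) * (\<integral>\<^sup>+ s. (ennreal (r t s * norm (g s)))\<^sup>2 \<partial>M)"
      by (rule Cauchy_Schwarz_nn_integral) measurable
    also have "\<dots> = (\<integral>\<^sup>+ s. ennreal (k t s) \<partial>M) * (\<integral>\<^sup>+ s. ennreal (k t s * (norm (g s))\<^sup>2) \<partial>M)"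
      by (simp add: ennreal_power r_nonneg r_sq power_mult_distrib)
    also have "\<dots> \<le> ennreal (1 / a) * (\<integral>\<^sup>+ s. ennreal (k t s * (norm (g s))\<^sup>2) \<partial>M)"
      unfolding k_def M_def by (intro mult_right_mono nn_integral_exp_kernel_past a) simp
    finally show ?thesis .
  qed
  have "energy x \<le> (\<integral>\<^sup>+ t. ennreal (1 / a) * (\<integral>\<^sup>+ s. ennreal (k t s * (norm (g s))\<^sup>2) \<partial>M) \<partial>M)"
    unfolding energy_def M_def[symmetric]
    by (rule nn_integral_mono) (use pointwise in \<open>auto simp: M_def\<close>)
  have km: "(\<lambda>p. ennreal (k (fst p) (snd p) * (norm (g (snd p)))\<^sup>2)) \<in> borel_measurable (M \<Otimes>\<^sub>M M)"
    using kk_meas by measurable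
  note \<open>energy x \<le> _\<close>
  also have "(\<integral>\<^sup>+ t. ennreal (1 / a) * (\<integral>\<^sup>+ s. ennreal (k t s * (norm (g s))\<^sup>2) \<partial>M) \<partial>M)
      = ennreal (1 / a) * (\<integral>\<^sup>+ t. \<integral>\<^sup>+ s. ennreal (k t s * (norm (g s))\<^sup>2) \<partial>M \<partial>M)"
    using M.borel_measurable_nn_integral_fst[OF km] by (intro nn_integral_cmult) simp
  also have "(\<integral>\<^sup>+ t. \<integral>\<^sup>+ s. ennreal (k t s * (norm (g s))\<^sup>2) \<partial>M \<partial>M)
      = (\<integral>\<^sup>+ s. \<integral>\<^sup>+ t. ennreal (k t s * (norm (g s))\<^sup>2) \<partial>M \<partial>M)"
    using MM.Fubini[OF km] by simp
  also have "\<dots> = (\<integral>\<^sup>+ s. ennreal (1 / a) * ennreal ((norm (g s))\<^sup>2) \<partial>M)"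
  proof (rule nn_integral_cong)
    fix s assume "s \<in> space M"
    then have s: "s \<ge> 0" by (simp add: M_def)
    have "(\<lambda>t. k t s) \<in> borel_measurable M"
      by (rule measurable_compose[OF id]) (simp add: k_def)
    then have "(\<integral>\<^sup>+ t. ennreal (k t s * (norm (g s))\<^sup>2) \<partial>M) = (\<integral>\<^sup>+ t. ennreal (k t s) \<partial>M) * ennreal ((norm (g s))\<^sup>2)"
      by (simp add: ennreal_mult k_nonneg nn_integral_multc)
    also have "(\<integral>\<^sup>+ t. ennreal (k t s) \<partial>M) = ennreal (1 / a)"
      unfolding k_def M_def by (rule nn_integral_exp_kernel_future[OF a s])
    finally show "(\<integral>\<^sup>+ t. ennreal (k t s * (norm (g s))\<^sup>2) \<partial>M) = ennreal (1 / a) * ennreal ((norm (g s))\<^sup>2)" .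
  qed
  also have "\<dots> = ennreal (1 / a) * energy g"
    unfolding energy_def M_def[symmetric] by (intro nn_integral_cmult) measurable
  also have "ennreal (1 / a) * (ennreal (1 / a) * energy g) = ennreal (1 / a\<^sup>2) * energy g"
    using a by (simp add: mult.assoc[symmetric] ennreal_mult[symmetric] power2_eq_square)
  finally show ?thesis .
qed

lemma scalar_equation_solution:
  fixes g :: "real \<Rightarrow> complex ^ 'n::finite"
  assumes l: "Re l < 0" and g: "g \<in> L2"
  obtains x where "solves (\<lambda>v. l *s v) g x" "energy x \<le> ennreal (1 / (Re l)\<^sup>2) * energy g"
proof -
  \<comment> \<open>Variation of constants.\<close>
  define \<phi> where "\<phi> s = exp (l * of_real s)" for s :: real
  define h where "h s = exp (- (l * of_real s)) *s g s" for s
  define x where "x t = \<phi> t *s integral {0..t} h" for t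
  have \<phi>h: "\<phi> s *s h s = g s" for s
    by (simp add: \<phi>_def h_def vector_smult_assoc exp_minus)
  have h: "h absolutely_integrable_on {0..t}" if "t \<ge> 0" for t
    unfolding h_def
  proof (rule integral_by_parts_indefinite_integral(2)[OF L2_absolutely_integrable[OF g] that])
    show "((\<lambda>s. exp (- (l * of_real s))) has_vector_derivative - l * exp (- (l * of_real s))) (at s)" for s
      by (rule has_vector_derivative_real_field) (auto intro!: derivative_eq_intros)
    show "continuous_on UNIV (\<lambda>s. - l * exp (- (l * of_real s)))"
      by (intro continuous_intros)
  qed
  have d: "(\<phi> has_vector_derivative l * \<phi> s) (at s)" for s
    unfolding \<phi>_def by (rule has_vector_derivative_real_field) (auto intro!: derivative_eq_intros)
  have c: "continuous_on UNIV (\<lambda>s. l * \<phi> s)" unfolding \<phi>_def by (intro continuous_intros)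
  have "solves (\<lambda>v. l *s v) g x"
    unfolding solves_def
  proof (intro allI impI)
    fix t :: real assume t: "t \<ge> 0"
    note p = integral_by_parts_indefinite_integral[OF h[OF t] t d c]
    have eq: "(\<lambda>s. l *s x s + g s) = (\<lambda>s. (l * \<phi> s) *s integral {0..s} h + \<phi> s *s h s)"
      by (simp add: x_def \<phi>h vector_smult_assoc)
    show "(\<lambda>s. l *s x s + g s) absolutely_integrable_on {0..t} \<and>
        x t = integral {0..t} (\<lambda>s. l *s x s + g s)"
      unfolding eq using set_integral_add(1)[OF p(1,2)] p(3)
        integral_add[OF p(1,2)[THEN set_lebesgue_integral_eq_integral(1)]]
      by (simp add: x_def)
  qed
  moreover have "energy x \<le> ennreal (1 / (- Re l)\<^sup>2) * energy g"
  proof (rule energy_exp_convolution_le)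
    show "g \<in> borel_measurable (lebesgue_on {0..})" using g by (simp add: L2_iff)
    show "- Re l > 0" using l by simp
    fix t :: real assume t: "t \<ge> 0"
    have hi: "integrable (lebesgue_on {0..t}) h"
      using h[OF t] by (simp add: integrable_restrict_space set_integrable_def)
    have "norm (x t) = exp (Re l * t) * norm (integral\<^sup>L (lebesgue_on {0..t}) h)"
      using lebesgue_integral_eq_integral[OF hi] by (simp add: x_def \<phi>_def norm_vector_scalar_mult)
    also have "ennreal \<dots> \<le> ennreal (exp (Re l * t)) * (\<integral>\<^sup>+ s. ennreal (norm (h s)) \<partial>lebesgue_on {0..t})"
      by (simp add: ennreal_mult mult_left_mono integral_norm_bound_ennreal[OF hi])
    also have "\<dots> = (\<integral>\<^sup>+ s. ennreal (exp (Re l * t) * norm (h s)) \<partial>lebesgue_on {0..t})"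
      using hi by (simp add: ennreal_mult nn_integral_cmult)
    also have "\<dots> = (\<integral>\<^sup>+ s. ennreal ((if s \<le> t then exp (- (- Re l * (t - s))) else 0) * norm (g s)) \<partial>lebesgue_on {0..})"
    proof -
      have R: "(\<integral>\<^sup>+ s. f s \<partial>lebesgue_on S) = (\<integral>\<^sup>+ s. f s * indicator S s \<partial>lebesgue)"
        if "S \<in> sets lebesgue" for f and S :: "real set"
        using that by (simp add: nn_integral_restrict_space)
      have "norm (h s) = exp (- (Re l * s)) * norm (g s)" for s
        by (simp add: h_def norm_vector_scalar_mult)
      moreover have "exp (Re l * t) * exp (- (Re l * s)) = exp (- (- Re l * (t - s)))" for s
        by (simp add: mult_exp_exp right_diff_distrib)
      ultimately have *: "exp (Re l * t) * norm (h s) = exp (- (- Re l * (t - s))) * norm (g s)" for s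
        by (simp add: mult.assoc[symmetric])
      show ?thesis
        unfolding * R[of "{0..t}", simplified] R[of "{0..}", simplified]
        by (rule nn_integral_cong) (simp split: split_indicator)
    qed
    finally show "ennreal (norm (x t)) \<le>
      (\<integral>\<^sup>+ s. ennreal ((if s \<le> t then exp (- (- Re l * (t - s))) else 0) * norm (g s)) \<partial>lebesgue_on {0..})" .
  qed
  ultimately show ?thesis using that by simp
qed

section \<open>Annihilating products of shifted matrices\<close>

text \<open>
  \<open>poly_act M p v\<close> is \<open>p(M) v\<close>, evaluated by Horner's scheme.
\<close>

definition poly_act :: "complex ^ 'n ^ 'n \<Rightarrow> complex poly \<Rightarrow> complex ^ 'n \<Rightarrow> complex ^ 'n" where
  "poly_act M p v = fold_coeffs (\<lambda>a w. a *s v + M *v w) p 0"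

lemma poly_act_0 [simp]: "poly_act M 0 v = 0"
  by (simp add: poly_act_def)

lemma poly_act_pCons [simp]: "poly_act M (pCons a p) v = a *s v + M *v poly_act M p v"
proof (cases "p = 0 \<and> a = 0")
  case False
  then show ?thesis
    by (cases "p = 0") (auto simp: poly_act_def)
qed simp

lemma poly_act_add: "poly_act M (p + q) v = poly_act M p v + poly_act M q v"
  by (induction p q rule: poly_induct2)
     (simp_all add: vec.add vec.scale_left_distrib matrix_vector_right_distrib algebra_simps)

lemma poly_act_smult: "poly_act M (smult c p) v = c *s poly_act M p v"
  by (induction p) (simp_all add: vec.scale_right_distrib vector_scalar_commute vector_smult_assoc)

text \<open>
  The operator \<open>M - l\<close>, acting on vectors.
\<close>

definition shift_op :: "complex ^ 'n ^ 'n \<Rightarrow> complex \<Rightarrow> complex ^ 'n \<Rightarrow> complex ^ 'n" where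
  "shift_op M l v = M *v v - l *s v"

lemma poly_act_root_factor: "poly_act M ([:- l, 1:] * p) v = shift_op M l (poly_act M p v)"
proof -
  have "[:- l, 1:] * p = pCons 0 p + smult (- l) p" by simp
  then show ?thesis
    unfolding shift_op_def by (simp only: poly_act_add poly_act_smult poly_act_pCons) simp
qed

lemma shift_op_0 [simp]: "shift_op M l 0 = 0"
  by (simp add: shift_op_def)

lemma shift_op_diff: "shift_op M l (v - w) = shift_op M l v - shift_op M l w"
  by (simp add: shift_op_def matrix_vector_mult_diff_distrib vec.scale_right_diff_distrib)

lemma shift_op_add: "shift_op M l (v + w) = shift_op M l v + shift_op M l w"
  by (simp add: shift_op_def matrix_vector_right_distrib vec.scale_right_distrib)

lemma shift_op_scale: "shift_op M l (c *s v) = c *s shift_op M l v"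
  by (simp add: shift_op_def vector_scalar_commute vec.scale_right_diff_distrib
      vector_smult_assoc mult.commute)

lemma shift_op_mult: "shift_op M l (M *v v) = M *v shift_op M l v"
  by (simp add: shift_op_def vector_scalar_commute matrix_vector_mult_diff_distrib)

lemma shift_op_commute: "shift_op M l (shift_op M k v) = shift_op M k (shift_op M l v)"
  unfolding shift_op_def[of M k] by (simp add: shift_op_diff shift_op_mult shift_op_scale)

text \<open>
  The product of the commuting operators \<open>M - l\<close> for \<open>l\<close> in a list; the head of the list acts first.
\<close>

fun shift_ops :: "complex ^ 'n ^ 'n \<Rightarrow> complex list \<Rightarrow> complex ^ 'n \<Rightarrow> complex ^ 'n" where
  "shift_ops M [] v = v"
| "shift_ops M (l # ls) v = shift_ops M ls (shift_op M l v)"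

lemma shift_ops_0 [simp]: "shift_ops M ls 0 = 0"
  by (induction ls) simp_all

lemma shift_ops_add: "shift_ops M ls (v + w) = shift_ops M ls v + shift_ops M ls w"
  by (induction ls arbitrary: v w) (simp_all add: shift_op_add)

lemma shift_ops_scale: "shift_ops M ls (c *s v) = c *s shift_ops M ls v"
  by (induction ls arbitrary: v) (simp_all add: shift_op_scale)

lemma shift_ops_sum: "shift_ops M ls (sum f A) = (\<Sum>i\<in>A. shift_ops M ls (f i))"
  by (induction A rule: infinite_finite_induct) (simp_all add: shift_ops_add)

lemma shift_ops_shift_op: "shift_ops M ls (shift_op M l v) = shift_op M l (shift_ops M ls v)"
proof (induction ls arbitrary: v)
  case (Cons k ls)
  then show ?case by (simp add: shift_op_commute[of M k l])
qed simp

lemma shift_ops_append: "shift_ops M (ks @ ls) v = shift_ops M ls (shift_ops M ks v)"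
  by (induction ks arbitrary: v) simp_all

lemma shift_ops_commute: "shift_ops M ks (shift_ops M ls v) = shift_ops M ls (shift_ops M ks v)"
  by (induction ks arbitrary: v) (simp_all add: shift_ops_shift_op[symmetric])

lemma poly_annihilates_imp_shift_ops:
  assumes "p \<noteq> 0" "poly_act M p v = 0"
  shows "\<exists>ls. shift_ops M ls v = 0"
  using assms
proof (induction "degree p" arbitrary: p v rule: less_induct)
  case less
  show ?case
  proof (cases "degree p = 0")
    case True
    then obtain c where "p = [:c:]" using degree_eq_zeroE by blast
    then have "v = 0" using less.prems by auto
    then show ?thesis by (intro exI[of _ "[]"]) simp
  next
    case False
    then have "\<not> constant (poly p)" by (simp add: constant_degree)
    then obtain l where "poly p l = 0" using fundamental_theorem_of_algebra by blast
    then obtain q where q: "p = [:- l, 1:] * q" by (metis dvdE poly_eq_0_iff_dvd)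
    have "q \<noteq> 0" using q less.prems by auto
    have "degree q < degree p"
      unfolding q by (subst degree_mult_eq) (use \<open>q \<noteq> 0\<close> in auto)
    have "poly_act M q (shift_op M l v) = shift_op M l (poly_act M q v)"
      by (induction q) (simp_all add: shift_op_add shift_op_scale shift_op_mult)
    also have "\<dots> = 0" using less.prems(2) q poly_act_root_factor[of M l q v] by simp
    finally obtain ls where "shift_ops M ls (shift_op M l v) = 0"
      using less.hyps[OF \<open>degree q < degree p\<close> \<open>q \<noteq> 0\<close>] by blast
    then show ?thesis by (intro exI[of _ "l # ls"]) simp
  qed
qed

text \<open>
  The vectors \<open>M^i v\<close> cannot all be independent, so some power of \<open>M\<close> maps \<open>v\<close> into the span of the
  lower ones.
\<close>

lemma ex_annihilating_poly: "\<exists>p. p \<noteq> 0 \<and> poly_act M p (v :: complex ^ 'n::finite) = 0"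
proof -
  define b where "b i = poly_act M (monom 1 i) v" for i
  define V where "V k = {poly_act M q v | q. \<forall>i\<ge>k. coeff q i = 0}" for k
  have VI: "poly_act M q v \<in> V k" if "\<forall>i\<ge>k. coeff q i = 0" for q k
    using that unfolding V_def by blast
  have span_V: "vec.span (b ` {..<k}) \<subseteq> V k" for k
  proof (rule vec.span_minimal)
    show "b ` {..<k} \<subseteq> V k" by (force simp: b_def intro: VI)
    show "vec.subspace (V k)"
    proof (rule vec.subspaceI)
      show "0 \<in> V k" using VI[of k 0] by simp
    next
      fix x y assume "x \<in> V k" "y \<in> V k"
      then obtain p q where pq: "x = poly_act M p v" "y = poly_act M q v"
        "\<forall>i\<ge>k. coeff p i = 0" "\<forall>i\<ge>k. coeff q i = 0" unfolding V_def by blast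
      then show "x + y \<in> V k" using VI[of k "p + q"] by (simp add: poly_act_add)
    next
      fix c x assume "x \<in> V k"
      then obtain p where "x = poly_act M p v" "\<forall>i\<ge>k. coeff p i = 0" unfolding V_def by blast
      then show "c *s x \<in> V k" using VI[of k "smult c p"] by (simp add: poly_act_smult)
    qed
  qed
  have "\<exists>k. b k \<in> vec.span (b ` {..<k})"
  proof (rule ccontr)
    assume "\<not> ?thesis"
    then have nin: "b k \<notin> vec.span (b ` {..<k})" for k by simp
    have ind: "vec.independent (b ` {..<k}) \<and> card (b ` {..<k}) = k" for k
    proof (induction k)
      case (Suc k)
      have "b k \<notin> b ` {..<k}" using nin[of k] vec.span_base[of "b k"] by metis
      with Suc show ?case
        using vec.independent_insertI[OF nin[of k]] by (simp add: lessThan_Suc)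
    qed (simp add: vec.independent_empty)
    have "k \<le> vec.dim (UNIV :: (complex ^ 'n) set)" for k
      using vec.independent_card_le_dim[OF subset_UNIV conjunct1[OF ind[of k]]] ind[of k] by simp
    then show False using Suc_n_not_le_n by blast
  qed
  then obtain k q where q: "b k = poly_act M q v" "\<forall>i\<ge>k. coeff q i = 0"
    using span_V unfolding V_def by fast
  have "monom 1 k + smult (-1) q \<noteq> 0"
  proof
    assume "monom 1 k + smult (-1) q = 0"
    then have "coeff (monom 1 k + smult (-1) q) k = 0" by simp
    with q(2) show False by simp
  qed
  moreover have "poly_act M (monom 1 k + smult (-1) q) v = 0"
    unfolding poly_act_add poly_act_smult using q(1) by (simp add: b_def)
  ultimately show ?thesis by blast
qed

lemma ex_shift_ops_annihilating_vector: "\<exists>ls. shift_ops M ls v = 0"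
  using ex_annihilating_poly[of M v] poly_annihilates_imp_shift_ops by blast

text \<open>
  Concatenating the lists that annihilate the unit vectors gives one that annihilates everything.
\<close>

lemma shift_ops_annihilate:
  obtains ls where "\<And>v. shift_ops M ls (v :: complex ^ 'n::finite) = 0"
proof -
  have ex: "\<exists>ls. \<forall>i\<in>A. shift_ops M ls (axis i 1) = 0" if "finite A" for A :: "'n set"
    using that
  proof (induction A rule: finite_induct)
    case (insert i A)
    then obtain ls where ls: "\<forall>i\<in>A. shift_ops M ls (axis i 1) = 0" by blast
    obtain ks where ks: "shift_ops M ks (axis i 1) = 0"
      using ex_shift_ops_annihilating_vector by blast
    have "\<forall>j\<in>insert i A. shift_ops M (ks @ ls) (axis j 1) = 0"
    proof
      fix j assume "j \<in> insert i A"
      then consider "j = i" | "j \<in> A" by blast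
      then show "shift_ops M (ks @ ls) (axis j 1) = 0"
      proof cases
        case 1
        then show ?thesis using ks by (simp add: shift_ops_append)
      next
        case 2
        then have "shift_ops M ks (shift_ops M ls (axis j 1)) = 0" using ls by simp
        then show ?thesis by (simp add: shift_ops_append shift_ops_commute[of M ls ks])
      qed
    qed
    then show ?case by blast
  qed simp
  obtain ls where "\<forall>i\<in>UNIV. shift_ops M ls (axis i 1) = 0"
    using ex[OF finite] ..
  then have ls: "shift_ops M ls (axis i 1) = 0" for i by simp
  have "shift_ops M ls v = 0" for v
  proof -
    have "shift_ops M ls v = shift_ops M ls (\<Sum>i\<in>UNIV. v $ i *s axis i 1)"
      by (simp add: basis_expansion)
    also have "\<dots> = 0" by (simp add: shift_ops_sum shift_ops_scale ls)
    finally show ?thesis .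
  qed
  then show ?thesis using that by blast
qed

text \<open>
  If \<open>l\<close> is not an eigenvalue, then \<open>M - l\<close> is injective and may be cancelled from the product.
\<close>

lemma shift_ops_filter_eigenvalues:
  assumes "shift_ops M ls v = 0"
  shows "shift_ops M (filter (eigenvalue M) ls) v = 0"
  using assms
proof (induction ls arbitrary: v)
  case (Cons l ls)
  let ?w = "shift_ops M (filter (eigenvalue M) ls) v"
  have w: "shift_op M l ?w = 0"
    using Cons.IH[of "shift_op M l v"] Cons.prems by (simp add: shift_ops_shift_op)
  show ?case
  proof (cases "eigenvalue M l")
    case True
    then show ?thesis using w by (simp add: shift_ops_shift_op)
  next
    case False
    moreover have "M *v ?w = l *s ?w" using w by (simp add: shift_op_def)
    ultimately have "?w = 0" unfolding eigenvalue_def by blast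
    then show ?thesis using False by simp
  qed
qed simp

lemma ex_annihilating_eigenvalues:
  obtains ls where "\<And>l. l \<in> set ls \<Longrightarrow> eigenvalue M l"
    and "\<And>v. shift_ops M ls (v :: complex ^ 'n::finite) = 0"
proof -
  obtain ls where "\<And>v. shift_ops M ls v = 0" using shift_ops_annihilate[of M] by blast
  then show ?thesis
    using that[of "filter (eigenvalue M) ls"] shift_ops_filter_eigenvalues[of M ls] by auto
qed

section \<open>The L2 gain of a Hurwitz matrix\<close>

lemma bounded_linear_shift_op: "bounded_linear (shift_op M l :: complex ^ 'n::finite \<Rightarrow> _)"
  unfolding shift_op_def
  by (intro bounded_linear_sub matrix_vector_mul_bounded_linear bounded_linear_vector_scalar_mult)

text \<open>
  Existence and energy bound by recursion on the annihilating product. In the step, \<open>w\<close> plays the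
  role of \<open>(M - l) x\<close>. It is constructed first, from the shorter product, and \<open>x\<close> then solves a scalar
  equation.
\<close>

lemma shift_ops_L2_gain:
  fixes M :: "complex ^ 'n::finite ^ 'n"
  assumes "\<And>l. l \<in> set ls \<Longrightarrow> Re l < 0"
  shows "\<exists>c\<ge>0. \<forall>f\<in>L2. (\<forall>t. shift_ops M ls (f t) = 0) \<longrightarrow>
    (\<exists>x. solves (\<lambda>v. M *v v) f x \<and> energy x \<le> ennreal c * energy f)"
  using assms
proof (induction ls)
  case Nil
  have "solves (\<lambda>v. M *v v) f (\<lambda>_. 0) \<and> energy (\<lambda>_. 0 :: complex ^ 'n) \<le> ennreal 0 * energy f"
    if "\<And>t. f t = 0" for f :: "real \<Rightarrow> complex ^ 'n"
    using that by (simp add: solves_def energy_def)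
  then have "\<forall>f\<in>L2. (\<forall>t. shift_ops M [] (f t) = 0) \<longrightarrow>
      (\<exists>x. solves (\<lambda>v. M *v v) f x \<and> energy x \<le> ennreal 0 * energy f)"
    unfolding shift_ops.simps by blast
  then show ?case by blast
next
  case (Cons l ls)
  then obtain c where c: "c \<ge> 0" and IH: "\<And>f. f \<in> L2 \<Longrightarrow> (\<And>t. shift_ops M ls (f t) = 0) \<Longrightarrow>
      \<exists>x. solves (\<lambda>v. M *v v) f x \<and> energy x \<le> ennreal c * energy f"
    by (metis list.set_intros(2))
  have l: "Re l < 0" using Cons.prems by simp
  obtain K where K: "\<And>v. norm (shift_op M l v) \<le> norm v * K"
    using bounded_linear.bounded[OF bounded_linear_shift_op] by blast
  define b where "b = 1 / (Re l)\<^sup>2"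
  have b: "b \<ge> 0" by (simp add: b_def)
  show ?case
  proof (intro exI[of _ "b * (2 * (c * K\<^sup>2) + 2)"] conjI ballI impI)
    show "b * (2 * (c * K\<^sup>2) + 2) \<ge> 0" using b c by simp
    fix f :: "real \<Rightarrow> complex ^ 'n"
    assume f: "f \<in> L2" and ann: "\<forall>t. shift_ops M (l # ls) (f t) = 0"
    define g where "g t = shift_op M l (f t)" for t
    have g: "g \<in> L2" unfolding g_def by (rule L2_linear[OF f bounded_linear_shift_op])
    have f_meas: "f \<in> borel_measurable (lebesgue_on {0..})" using f by (simp add: L2_iff)
    have energy_g: "energy g \<le> ennreal (K\<^sup>2) * energy f"
      using K by (intro energy_mono_scaled f_meas) (simp add: g_def mult.commute)
    obtain w where w: "solves (\<lambda>v. M *v v) g w" and energy_w: "energy w \<le> ennreal c * energy g"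
      using IH[OF g] ann by (auto simp: g_def)
    have w_meas: "w \<in> borel_measurable (lebesgue_on {0..})" by (rule solves_borel_measurable[OF w])
    have w_L2: "w \<in> L2"
      using le_less_trans[OF energy_w, of \<infinity>] g w_meas by (simp add: L2_iff ennreal_mult_less_top)
    obtain x where x: "solves (\<lambda>v. l *s v) (\<lambda>t. w t + f t) x"
      and energy_x: "energy x \<le> ennreal b * energy (\<lambda>t. w t + f t)"
      using scalar_equation_solution[OF l L2_add[OF w_L2 f]] unfolding b_def by blast
    \<comment> \<open>\<open>(M - l) x\<close> and \<open>w\<close> solve the same scalar equation, hence agree.\<close>
    have "solves (\<lambda>v. l *s v) (\<lambda>t. shift_op M l (w t + f t)) (\<lambda>t. shift_op M l (x t))"
      using x bounded_linear_shift_op by (rule solves_linear_image) (simp add: shift_op_scale)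
    moreover have "solves (\<lambda>v. l *s v) (\<lambda>t. shift_op M l (w t + f t)) w"
      using w by (rule solves_cong) (simp_all add: g_def shift_op_add shift_op_def matrix_vector_right_distrib)
    ultimately have xw: "shift_op M l (x t) = w t" if "t \<ge> 0" for t
      using bounded_linear_vector_scalar_mult that by (rule solves_unique)
    have "solves (\<lambda>v. M *v v) f x"
      using x
    proof (rule solves_cong)
      fix t :: real assume "t \<ge> 0"
      then have "w t = M *v x t - l *s x t" using xw by (simp add: shift_op_def)
      then show "l *s x t + (w t + f t) = M *v x t + f t" by simp
    qed simp
    moreover have "energy x \<le> ennreal (b * (2 * (c * K\<^sup>2) + 2)) * energy f"
    proof -
      note energy_x
      also have "energy (\<lambda>t. w t + f t) \<le> ennreal 2 * energy w + ennreal 2 * energy f"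
        using energy_add_le[OF w_meas f_meas, of 1] by simp
      also have "energy w \<le> ennreal c * (ennreal (K\<^sup>2) * energy f)"
        using energy_w energy_g by (meson mult_left_mono order_trans zero_le)
      finally have "energy x \<le> ennreal b *
          (ennreal 2 * (ennreal c * (ennreal (K\<^sup>2) * energy f)) + ennreal 2 * energy f)"
        by (simp add: add_mono mult_left_mono)
      also have "\<dots> = ennreal (b * (2 * (c * K\<^sup>2) + 2)) * energy f"
        using b c by (simp add: ennreal_mult ennreal_plus distrib_left distrib_right mult.assoc del: ennreal_numeral)
      finally show ?thesis .
    qed
    ultimately show "\<exists>x. solves (\<lambda>v. M *v v) f x \<and>
        energy x \<le> ennreal (b * (2 * (c * K\<^sup>2) + 2)) * energy f" by blast
  qed
qed

lemma hurwitz_L2_gain: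
  fixes A :: "real ^ 'n::finite ^ 'n"
  assumes "hurwitz A"
  shows "\<exists>c\<ge>0. \<forall>f\<in>L2. \<exists>x. solves (\<lambda>v. A *v v) f x \<and> energy x \<le> ennreal c * energy f"
proof -
  define M where "M = map_matrix complex_of_real A"
  \<comment> \<open>Solve the complexified equation and take real parts.\<close>
  define cplx :: "real ^ 'n \<Rightarrow> complex ^ 'n" where "cplx v = (\<chi> i. complex_of_real (v $ i))" for v
  define re :: "complex ^ 'n \<Rightarrow> real ^ 'n" where "re z = (\<chi> i. Re (z $ i))" for z
  obtain ls where ls: "\<And>l. l \<in> set ls \<Longrightarrow> eigenvalue M l" "\<And>v. shift_ops M ls v = 0"
    using ex_annihilating_eigenvalues[of M] by blast
  have "Re l < 0" if "l \<in> set ls" for l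
    using assms ls(1)[OF that] by (simp add: hurwitz_def M_def)
  from shift_ops_L2_gain[of ls M, OF this] obtain c where c: "c \<ge> 0"
    and gain: "\<And>f. f \<in> L2 \<Longrightarrow> \<exists>x. solves (\<lambda>v. M *v v) f x \<and> energy x \<le> ennreal c * energy f"
    using ls(2) by auto
  have cplx: "bounded_linear cplx"
    by (simp add: linear_conv_bounded_linear[symmetric] linear_iff cplx_def vec_eq_iff complex_eq_iff)
  have re: "bounded_linear re"
    by (simp add: linear_conv_bounded_linear[symmetric] linear_iff re_def vec_eq_iff)
  have norm_cplx: "norm (cplx v) = norm v" for v
    by (simp add: norm_vec_def cplx_def)
  have norm_re: "norm (re z) \<le> norm z" for z
    unfolding norm_vec_def re_def by (intro L2_set_mono) (simp_all add: abs_Re_le_cmod)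
  have re_cplx: "re (cplx v) = v" for v by (simp add: re_def cplx_def vec_eq_iff)
  have re_M: "re (M *v z) = A *v re z" for z
    by (simp add: re_def M_def map_matrix_def matrix_vector_mult_def vec_eq_iff)
  have "\<exists>x. solves (\<lambda>v. A *v v) f x \<and> energy x \<le> ennreal c * energy f" if f: "f \<in> L2" for f
  proof -
    obtain z where z: "solves (\<lambda>v. M *v v) (\<lambda>t. cplx (f t)) z"
      and energy_z: "energy z \<le> ennreal c * energy (\<lambda>t. cplx (f t))"
      using gain[OF L2_linear[OF f cplx]] by blast
    have "solves (\<lambda>v. A *v v) (\<lambda>t. re (cplx (f t))) (\<lambda>t. re (z t))"
      using z re re_M by (rule solves_linear_image)
    moreover have "energy (\<lambda>t. re (z t)) \<le> ennreal c * energy f"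
    proof -
      have "energy (\<lambda>t. re (z t)) \<le> energy z"
        using energy_mono_scaled[OF solves_borel_measurable[OF z], of "\<lambda>t. re (z t)" 1] norm_re by simp
      with energy_z show ?thesis by (simp add: energy_def norm_cplx)
    qed
    ultimately show ?thesis by (auto simp: re_cplx)
  qed
  with c show ?thesis by blast
qed

section \<open>Systems, their outputs and similarity\<close>

text \<open>
  The inhomogeneity that input and disturbance produce in the state equation.
\<close>

abbreviation forcing :: "('n::finite, 'm::finite, 'q::finite, 'p::finite) linear_system \<Rightarrow>
    (real \<Rightarrow> real ^ 'm) \<Rightarrow> (real \<Rightarrow> real ^ 'q) \<Rightarrow> real \<Rightarrow> real ^ 'n" where
  "forcing S u d \<equiv> \<lambda>t. sysB S *v u t + sysE S *v d t"

lemma is_trajectory_iff_solves: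
  "is_trajectory S 0 0 u d x \<longleftrightarrow> solves (\<lambda>v. sysA S *v v) (forcing S u d) x"
  by (simp add: is_trajectory_def solves_def add.assoc)

lemma forcing_L2: "u \<in> L2 \<Longrightarrow> d \<in> L2 \<Longrightarrow> forcing S u d \<in> L2"
  by (rule L2_add; rule L2_linear[OF _ matrix_vector_mul_bounded_linear])

text \<open>
  Existence and uniqueness of trajectories turn the description operator in \<open>state\<close> into an actual
  solution.
\<close>

lemma state_solves:
  assumes "zero_asymptotically_stable S" "u \<in> L2" "d \<in> L2"
  shows "solves (\<lambda>v. sysA S *v v) (forcing S u d) (\<lambda>t. state S t 0 0 u d)"
proof -
  obtain c where "c \<ge> 0" and gain: "\<And>f. f \<in> L2 \<Longrightarrow> \<exists>x. solves (\<lambda>v. sysA S *v v) f x \<and> energy x \<le> ennreal c * energy f"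
    using hurwitz_L2_gain[OF assms(1)[unfolded zero_asymptotically_stable_def]] by blast
  obtain x where x: "solves (\<lambda>v. sysA S *v v) (forcing S u d) x"
    using gain[OF forcing_L2[OF assms(2,3), of S]] by blast
  have "state S t 0 0 u d = x t" if t: "t \<ge> 0" for t
    unfolding state_def is_trajectory_iff_solves
  proof (rule the_equality)
    show "\<exists>y. solves (\<lambda>v. sysA S *v v) (forcing S u d) y \<and> y t = x t" using x by blast
    show "z = x t" if "\<exists>y. solves (\<lambda>v. sysA S *v v) (forcing S u d) y \<and> y t = z" for z
      using that solves_unique[OF _ x matrix_vector_mul_bounded_linear t] by blast
  qed
  then show ?thesis using x by (intro solves_cong[OF x]) simp_all
qed

lemma borel_measurable_output_at:
  assumes "zero_asymptotically_stable S" "u \<in> L2" "d \<in> L2"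
  shows "(\<lambda>t. output_at S t 0 0 u d) \<in> borel_measurable (lebesgue_on {0..})"
  unfolding output_at_def
  by (rule measurable_compose[OF solves_borel_measurable[OF state_solves[OF assms]]])
     (intro borel_measurable_continuous_onI linear_continuous_on matrix_vector_mul_bounded_linear)

lemma incremental_L2_gain:
  fixes S :: "('n::finite, 'm::finite, 'q::finite, 'p::finite) linear_system"
  assumes S: "zero_asymptotically_stable S"
  shows "\<exists>\<gamma>>0. \<forall>u1\<in>L2. \<forall>u2\<in>L2. \<forall>d\<in>L2.
    energy (\<lambda>t. output_at S t 0 0 u1 d - output_at S t 0 0 u2 d) \<le> ennreal \<gamma> * energy (\<lambda>t. u1 t - u2 t)"
proof -
  obtain c where c: "c \<ge> 0"
    and gain: "\<And>f. f \<in> L2 \<Longrightarrow> \<exists>x. solves (\<lambda>v. sysA S *v v) f x \<and> energy x \<le> ennreal c * energy f"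
    using hurwitz_L2_gain[OF S[unfolded zero_asymptotically_stable_def]] by blast
  obtain KB where KB: "\<And>v. norm (sysB S *v v) \<le> norm v * KB"
    using bounded_linear.bounded[OF matrix_vector_mul_bounded_linear] by blast
  obtain KC where KC: "\<And>v. norm (sysC S *v v) \<le> norm v * KC"
    using bounded_linear.bounded[OF matrix_vector_mul_bounded_linear] by blast
  \<comment> \<open>The summand 1 only ensures that the gain is positive.\<close>
  define \<gamma> where "\<gamma> = KC\<^sup>2 * (c * KB\<^sup>2) + 1"
  have "energy (\<lambda>t. output_at S t 0 0 u1 d - output_at S t 0 0 u2 d) \<le> ennreal \<gamma> * energy (\<lambda>t. u1 t - u2 t)"
    if u1: "u1 \<in> L2" and u2: "u2 \<in> L2" and d: "d \<in> L2" for u1 u2 d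
  proof -
    define f where "f t = sysB S *v (u1 t - u2 t)" for t
    have u: "(\<lambda>t. u1 t - u2 t) \<in> L2" by (rule L2_diff[OF u1 u2])
    have f: "f \<in> L2" unfolding f_def by (rule L2_linear[OF u matrix_vector_mul_bounded_linear])
    obtain x where x: "solves (\<lambda>v. sysA S *v v) f x" and energy_x: "energy x \<le> ennreal c * energy f"
      using gain[OF f] by blast
    have "solves (\<lambda>v. sysA S *v v) (\<lambda>t. forcing S u1 d t - forcing S u2 d t)
        (\<lambda>t. state S t 0 0 u1 d - state S t 0 0 u2 d)"
      by (intro solves_diff state_solves S u1 u2 d matrix_vector_mul_bounded_linear)
    moreover have "(\<lambda>t. forcing S u1 d t - forcing S u2 d t) = f"
      by (simp add: f_def matrix_vector_mult_diff_distrib fun_eq_iff)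
    ultimately have eq: "state S t 0 0 u1 d - state S t 0 0 u2 d = x t" if "t \<ge> 0" for t
      using solves_unique[OF _ x matrix_vector_mul_bounded_linear that] by simp
    have "energy (\<lambda>t. output_at S t 0 0 u1 d - output_at S t 0 0 u2 d) = energy (\<lambda>t. sysC S *v x t)"
      by (rule energy_cong) (simp add: output_at_def matrix_vector_mult_diff_distrib[symmetric] eq)
    also have "\<dots> \<le> ennreal (KC\<^sup>2) * energy x"
      using KC by (intro energy_mono_scaled solves_borel_measurable[OF x]) (simp add: mult.commute)
    also have "\<dots> \<le> ennreal (KC\<^sup>2) * (ennreal c * (ennreal (KB\<^sup>2) * energy (\<lambda>t. u1 t - u2 t)))"
    proof -
      have "energy f \<le> ennreal (KB\<^sup>2) * energy (\<lambda>t. u1 t - u2 t)"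
        using KB u unfolding f_def L2_iff by (intro energy_mono_scaled) (simp_all add: mult.commute)
      then have "ennreal c * energy f \<le> ennreal c * (ennreal (KB\<^sup>2) * energy (\<lambda>t. u1 t - u2 t))"
        by (rule mult_left_mono) simp
      from order_trans[OF energy_x this] show ?thesis by (rule mult_left_mono) simp
    qed
    also have "\<dots> = ennreal (KC\<^sup>2 * (c * KB\<^sup>2)) * energy (\<lambda>t. u1 t - u2 t)"
      using c by (simp add: ennreal_mult mult.assoc)
    also have "\<dots> \<le> ennreal \<gamma> * energy (\<lambda>t. u1 t - u2 t)"
      by (intro mult_right_mono ennreal_leI) (simp_all add: \<gamma>_def)
    finally show ?thesis .
  qed
  moreover have "\<gamma> > 0" using c unfolding \<gamma>_def by (intro add_nonneg_pos) simp_all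
  ultimately show ?thesis by blast
qed

lemma L2_real_energy:
  assumes "u \<in> L2"
  obtains r where "r \<ge> 0" "energy u = ennreal r" "l2_norm_sq u = ereal r"
proof -
  obtain r where r: "r \<ge> 0" "energy u = ennreal r"
    using assms by (cases "energy u") (simp_all add: L2_iff)
  then have "l2_norm_sq u = ereal r"
    unfolding l2_norm_sq_def energy_def[symmetric] by (simp add: enn2ereal_ennreal)
  with r that show ?thesis by blast
qed

lemma l2_norm_sq_le_iff: "r \<ge> 0 \<Longrightarrow> l2_norm_sq u \<le> ereal r \<longleftrightarrow> energy u \<le> ennreal r"
  unfolding l2_norm_sq_def energy_def[symmetric]
  by (simp add: less_eq_ennreal.rep_eq enn2ereal_ennreal)

lemma l2_norm_sq_le_ereal:
  assumes "l2_norm_sq u \<le> ereal r"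
  shows "\<exists>s\<ge>0. energy u = ennreal s \<and> s \<le> r"
proof -
  have "0 \<le> l2_norm_sq u" by (simp add: l2_norm_sq_def)
  from order_trans[OF this assms] have r: "r \<ge> 0" by simp
  then have le: "energy u \<le> ennreal r" using assms by (simp add: l2_norm_sq_le_iff)
  then obtain s where s: "s \<ge> 0" "energy u = ennreal s"
    by (cases "energy u") (simp_all add: top_unique)
  with le r show ?thesis by auto
qed

lemma energy_Pair:
  assumes "u \<in> borel_measurable (lebesgue_on {0..})" "v \<in> borel_measurable (lebesgue_on {0..})"
  shows "energy (\<lambda>t. (u t, v t)) = energy u + energy v"
  unfolding energy_def
  using assms by (subst nn_integral_add[symmetric]) (simp_all add: norm_Pair ennreal_plus)

lemma l2_norm_sq_Pair:
  assumes "u \<in> L2" "v \<in> L2" "l2_norm_sq u = ereal r" "l2_norm_sq v = ereal s"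
  shows "l2_norm_sq (\<lambda>t. (u t, v t)) = ereal (r + s)"
proof -
  have "energy (\<lambda>t. (u t, v t)) = energy u + energy v"
    using assms(1,2) by (intro energy_Pair) (simp_all add: L2_iff)
  then show ?thesis
    using assms(3,4) by (simp add: l2_norm_sq_def energy_def plus_ennreal.rep_eq)
qed

lemma similarI:
  fixes S1 :: "('n1::finite, 'm::finite, 'q1::finite, 'p::finite) linear_system"
    and S2 :: "('n2::finite, 'm, 'q2::finite, 'p) linear_system"
  assumes "\<epsilon> > 0" "\<eta> > 0" "\<mu> > 0"
    and "\<And>u1 u2 d1. u1 \<in> L2 \<Longrightarrow> u2 \<in> L2 \<Longrightarrow> d1 \<in> L2 \<Longrightarrow> \<exists>d2\<in>L2.
      l2_norm_sq (\<lambda>t. output_at S1 t 0 0 u1 d1 - output_at S2 t 0 0 u2 d2)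
      \<le> ereal \<gamma> * l2_norm_sq (\<lambda>t. u1 t - u2 t) + ereal (\<delta> - \<epsilon>) * l2_norm_sq (\<lambda>t. (u1 t, u2 t))
        + ereal (\<mu> - \<epsilon>) * l2_norm_sq d1 - ereal \<eta> * l2_norm_sq d2"
  shows "similar \<gamma> \<delta> S1 S2"
  unfolding similar_def
  by (rule exI[of _ \<epsilon>], rule conjI, rule assms(1), rule exI[of _ \<eta>], rule conjI, rule assms(2),
      rule exI[of _ \<mu>], rule conjI, rule assms(3)) (intro ballI assms(4))

lemma similar_self:
  fixes S :: "('n::finite, 'm::finite, 'q::finite, 'p::finite) linear_system"
  assumes S: "zero_asymptotically_stable S"
  shows "\<exists>\<gamma>>0. \<forall>\<delta>>0. similar \<gamma> \<delta> S S"
proof -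
  obtain \<gamma> where \<gamma>: "\<gamma> > 0" and gain: "\<And>u1 u2 d. u1 \<in> L2 \<Longrightarrow> u2 \<in> L2 \<Longrightarrow> d \<in> L2 \<Longrightarrow>
      energy (\<lambda>t. output_at S t 0 0 u1 d - output_at S t 0 0 u2 d) \<le> ennreal \<gamma> * energy (\<lambda>t. u1 t - u2 t)"
    using incremental_L2_gain[OF S] by blast
  have "similar \<gamma> \<delta> S S" if \<delta>: "\<delta> > 0" for \<delta>
  \<comment> \<open>With \<open>d2 = d\<close>, the choice \<open>\<mu> - \<epsilon> = \<eta> = 1\<close> makes the two disturbance terms cancel.\<close>
  proof (rule similarI[where \<epsilon> = "\<delta>/2" and \<eta> = 1 and \<mu> = "1 + \<delta>/2"])
    fix u1 u2 :: "real \<Rightarrow> real ^ 'm" and d :: "real \<Rightarrow> real ^ 'q"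
    assume u1: "u1 \<in> L2" and u2: "u2 \<in> L2" and d: "d \<in> L2"
    obtain r where r: "r \<ge> 0" "energy (\<lambda>t. u1 t - u2 t) = ennreal r" "l2_norm_sq (\<lambda>t. u1 t - u2 t) = ereal r"
      using L2_real_energy[OF L2_diff[OF u1 u2]] by blast
    obtain a where a: "a \<ge> 0" "l2_norm_sq u1 = ereal a" using L2_real_energy[OF u1] by blast
    obtain b where b: "b \<ge> 0" "l2_norm_sq u2 = ereal b" using L2_real_energy[OF u2] by blast
    obtain e where e: "l2_norm_sq d = ereal e" using L2_real_energy[OF d] by blast
    have ab: "l2_norm_sq (\<lambda>t. (u1 t, u2 t)) = ereal (a + b)"
      by (rule l2_norm_sq_Pair[OF u1 u2 a(2) b(2)])
    have "energy (\<lambda>t. output_at S t 0 0 u1 d - output_at S t 0 0 u2 d) \<le> ennreal (\<gamma> * r)"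
      using gain[OF u1 u2 d] r \<gamma> by (simp add: ennreal_mult)
    then have "l2_norm_sq (\<lambda>t. output_at S t 0 0 u1 d - output_at S t 0 0 u2 d) \<le> ereal (\<gamma> * r)"
      using r \<gamma> by (simp add: l2_norm_sq_le_iff)
    also have "\<dots> \<le> ereal (\<gamma> * r + \<delta>/2 * (a + b))" using \<delta> a b by simp
    finally have "l2_norm_sq (\<lambda>t. output_at S t 0 0 u1 d - output_at S t 0 0 u2 d)
        \<le> ereal \<gamma> * l2_norm_sq (\<lambda>t. u1 t - u2 t) + ereal (\<delta> - \<delta>/2) * l2_norm_sq (\<lambda>t. (u1 t, u2 t))
          + ereal (1 + \<delta>/2 - \<delta>/2) * l2_norm_sq d - ereal 1 * l2_norm_sq d"
      unfolding r(3) ab e by simp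
    then show "\<exists>d2\<in>L2. l2_norm_sq (\<lambda>t. output_at S t 0 0 u1 d - output_at S t 0 0 u2 d2)
        \<le> ereal \<gamma> * l2_norm_sq (\<lambda>t. u1 t - u2 t) + ereal (\<delta> - \<delta>/2) * l2_norm_sq (\<lambda>t. (u1 t, u2 t))
          + ereal (1 + \<delta>/2 - \<delta>/2) * l2_norm_sq d - ereal 1 * l2_norm_sq d2"
      using d by (rule bexI[where x = d])
  qed (use \<delta> in simp_all)
  with \<gamma> show ?thesis by blast
qed

lemma similar_trans:
  fixes S1 :: "('n1::finite, 'k::finite, 'q1::finite, 'r::finite) linear_system"
    and S2 :: "('n2::finite, 'k, 'q2::finite, 'r) linear_system"
    and S3 :: "('n3::finite, 'k, 'q3::finite, 'r) linear_system"
  assumes S1: "zero_asymptotically_stable S1" and S2: "zero_asymptotically_stable S2"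
    and S3: "zero_asymptotically_stable S3"
    and \<gamma>23: "\<gamma>23 > 0"
    and sim12: "similar \<gamma>12 \<delta>12 S1 S2" and sim23: "similar \<gamma>23 \<delta>23 S2 S3"
  shows "\<exists>\<gamma>13>0. \<exists>\<delta>13>0. similar \<gamma>13 \<delta>13 S1 S3"
proof -
  obtain \<epsilon>1 \<eta>1 \<mu>1 where "\<eta>1 > 0" and sim1:
    "\<And>u1 u2 d1. u1 \<in> L2 \<Longrightarrow> u2 \<in> L2 \<Longrightarrow> d1 \<in> L2 \<Longrightarrow> \<exists>d2\<in>L2.
      l2_norm_sq (\<lambda>t. output_at S1 t 0 0 u1 d1 - output_at S2 t 0 0 u2 d2)
      \<le> ereal \<gamma>12 * l2_norm_sq (\<lambda>t. u1 t - u2 t) + ereal (\<delta>12 - \<epsilon>1) * l2_norm_sq (\<lambda>t. (u1 t, u2 t))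
        + ereal (\<mu>1 - \<epsilon>1) * l2_norm_sq d1 - ereal \<eta>1 * l2_norm_sq d2"
    using sim12 unfolding similar_def by blast
  obtain \<epsilon>2 \<eta>2 \<mu>2 where "\<eta>2 > 0" and sim2:
    "\<And>u2 u3 d2. u2 \<in> L2 \<Longrightarrow> u3 \<in> L2 \<Longrightarrow> d2 \<in> L2 \<Longrightarrow> \<exists>d3\<in>L2.
      l2_norm_sq (\<lambda>t. output_at S2 t 0 0 u2 d2 - output_at S3 t 0 0 u3 d3)
      \<le> ereal \<gamma>23 * l2_norm_sq (\<lambda>t. u2 t - u3 t) + ereal (\<delta>23 - \<epsilon>2) * l2_norm_sq (\<lambda>t. (u2 t, u3 t))
        + ereal (\<mu>2 - \<epsilon>2) * l2_norm_sq d2 - ereal \<eta>2 * l2_norm_sq d3"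
    using sim23 unfolding similar_def by blast
  \<comment> \<open>Chosen so that the coefficient of \<open>\<parallel>d2\<parallel>\<^sup>2\<close> in the final estimate is not positive.\<close>
  define k where "k = \<bar>\<mu>2 - \<epsilon>2\<bar> / \<eta>1 + 1"
  have k: "k > 0" using \<open>\<eta>1 > 0\<close> unfolding k_def by (intro add_nonneg_pos) simp_all
  have k_\<eta>1: "(1 + 1/k) * (\<mu>2 - \<epsilon>2) \<le> (1 + k) * \<eta>1"
  proof -
    have "\<mu>2 - \<epsilon>2 \<le> k * \<eta>1" using \<open>\<eta>1 > 0\<close> by (simp add: k_def distrib_right)
    then have "(1 + 1/k) * (\<mu>2 - \<epsilon>2) \<le> (1 + 1/k) * (k * \<eta>1)"
      using k by (intro mult_left_mono) simp_all
    also have "\<dots> = (1 + k) * \<eta>1" using k by (simp add: field_simps)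
    finally show ?thesis .
  qed
  \<comment> \<open>Absolute values, since \<open>\<delta> - \<epsilon>\<close> and \<open>\<mu> - \<epsilon>\<close> may be negative. The factor 2 comes from the pair \<open>(u1, u1)\<close>.\<close>
  define \<beta> where "\<beta> = (1 + k) * (2 * \<bar>\<delta>12 - \<epsilon>1\<bar>) + (1 + 1/k) * \<bar>\<delta>23 - \<epsilon>2\<bar>"
  define \<nu> where "\<nu> = (1 + k) * \<bar>\<mu>1 - \<epsilon>1\<bar>"
  have \<beta>: "\<beta> \<ge> 0" and \<nu>: "\<nu> \<ge> 0" using k by (simp_all add: \<beta>_def \<nu>_def)
  have "similar ((1 + 1/k) * \<gamma>23) (\<beta> + 1) S1 S3"
  proof (rule similarI[where \<epsilon> = 1 and \<eta> = "(1 + 1/k) * \<eta>2" and \<mu> = "\<nu> + 1"])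
    fix u1 u3 :: "real \<Rightarrow> real ^ 'k" and d1 :: "real \<Rightarrow> real ^ 'q1"
    assume u1: "u1 \<in> L2" and u3: "u3 \<in> L2" and d1: "d1 \<in> L2"
    obtain d2 where d2: "d2 \<in> L2" and le12:
      "l2_norm_sq (\<lambda>t. output_at S1 t 0 0 u1 d1 - output_at S2 t 0 0 u1 d2)
      \<le> ereal \<gamma>12 * l2_norm_sq (\<lambda>t. u1 t - u1 t) + ereal (\<delta>12 - \<epsilon>1) * l2_norm_sq (\<lambda>t. (u1 t, u1 t))
        + ereal (\<mu>1 - \<epsilon>1) * l2_norm_sq d1 - ereal \<eta>1 * l2_norm_sq d2"
      using sim1[OF u1 u1 d1] by blast
    obtain d3 where d3: "d3 \<in> L2" and le23:
      "l2_norm_sq (\<lambda>t. output_at S2 t 0 0 u1 d2 - output_at S3 t 0 0 u3 d3)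
      \<le> ereal \<gamma>23 * l2_norm_sq (\<lambda>t. u1 t - u3 t) + ereal (\<delta>23 - \<epsilon>2) * l2_norm_sq (\<lambda>t. (u1 t, u3 t))
        + ereal (\<mu>2 - \<epsilon>2) * l2_norm_sq d2 - ereal \<eta>2 * l2_norm_sq d3"
      using sim2[OF u1 u3 d2] by blast
    obtain U1 where U1: "U1 \<ge> 0" "l2_norm_sq u1 = ereal U1" using L2_real_energy[OF u1] by blast
    obtain U3 where U3: "U3 \<ge> 0" "l2_norm_sq u3 = ereal U3" using L2_real_energy[OF u3] by blast
    obtain V where V: "V \<ge> 0" "l2_norm_sq (\<lambda>t. u1 t - u3 t) = ereal V"
      using L2_real_energy[OF L2_diff[OF u1 u3]] by blast
    obtain D1 where D1: "D1 \<ge> 0" "l2_norm_sq d1 = ereal D1" using L2_real_energy[OF d1] by blast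
    obtain D2 where D2: "D2 \<ge> 0" "l2_norm_sq d2 = ereal D2" using L2_real_energy[OF d2] by blast
    obtain D3 where D3: "D3 \<ge> 0" "l2_norm_sq d3 = ereal D3" using L2_real_energy[OF d3] by blast
    have zero: "l2_norm_sq (\<lambda>t. u1 t - u1 t) = ereal 0" by (simp add: l2_norm_sq_def zero_ennreal.rep_eq zero_ereal_def)
    have U13: "l2_norm_sq (\<lambda>t. (u1 t, u3 t)) = ereal (U1 + U3)"
      by (rule l2_norm_sq_Pair[OF u1 u3 U1(2) U3(2)])
    have U11: "l2_norm_sq (\<lambda>t. (u1 t, u1 t)) = ereal (U1 + U1)"
      by (rule l2_norm_sq_Pair[OF u1 u1 U1(2) U1(2)])
    have "l2_norm_sq (\<lambda>t. output_at S1 t 0 0 u1 d1 - output_at S2 t 0 0 u1 d2)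
        \<le> ereal ((\<delta>12 - \<epsilon>1) * (U1 + U1) + (\<mu>1 - \<epsilon>1) * D1 - \<eta>1 * D2)"
      using le12 unfolding zero U11 D1(2) D2(2) by simp
    then obtain a where a: "a \<ge> 0"
      "energy (\<lambda>t. output_at S1 t 0 0 u1 d1 - output_at S2 t 0 0 u1 d2) = ennreal a"
      "a \<le> (\<delta>12 - \<epsilon>1) * (U1 + U1) + (\<mu>1 - \<epsilon>1) * D1 - \<eta>1 * D2"
      using l2_norm_sq_le_ereal by blast
    have "l2_norm_sq (\<lambda>t. output_at S2 t 0 0 u1 d2 - output_at S3 t 0 0 u3 d3)
        \<le> ereal (\<gamma>23 * V + (\<delta>23 - \<epsilon>2) * (U1 + U3) + (\<mu>2 - \<epsilon>2) * D2 - \<eta>2 * D3)"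
      using le23 unfolding V(2) U13 D2(2) D3(2) by simp
    then obtain b where b: "b \<ge> 0"
      "energy (\<lambda>t. output_at S2 t 0 0 u1 d2 - output_at S3 t 0 0 u3 d3) = ennreal b"
      "b \<le> \<gamma>23 * V + (\<delta>23 - \<epsilon>2) * (U1 + U3) + (\<mu>2 - \<epsilon>2) * D2 - \<eta>2 * D3"
      using l2_norm_sq_le_ereal by blast
    have "energy (\<lambda>t. output_at S1 t 0 0 u1 d1 - output_at S3 t 0 0 u3 d3)
        \<le> ennreal (1 + k) * ennreal a + ennreal (1 + 1/k) * ennreal b"
    proof -
      note m = borel_measurable_output_at[OF S1 u1 d1] borel_measurable_output_at[OF S2 u1 d2]
        borel_measurable_output_at[OF S3 u3 d3]
      show ?thesis
        using energy_add_le[OF borel_measurable_diff[OF m(1,2)] borel_measurable_diff[OF m(2,3)] k]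
        unfolding a(2) b(2) by simp
    qed
    also have "\<dots> = ennreal ((1 + k) * a + (1 + 1/k) * b)"
    proof -
      have "1 + k \<ge> 0" "1 + 1/k \<ge> 0" using k by simp_all
      then show ?thesis
        using a(1) b(1) by (simp only: ennreal_mult[symmetric] ennreal_plus mult_nonneg_nonneg)
    qed
    finally have "l2_norm_sq (\<lambda>t. output_at S1 t 0 0 u1 d1 - output_at S3 t 0 0 u3 d3)
        \<le> ereal ((1 + k) * a + (1 + 1/k) * b)"
      using k a(1) b(1) by (simp add: l2_norm_sq_le_iff)
    also have "(1 + k) * a + (1 + 1/k) * b
        \<le> (1 + 1/k) * \<gamma>23 * V + \<beta> * (U1 + U3) + \<nu> * D1 - (1 + 1/k) * \<eta>2 * D3"
    proof -
      have "(\<delta>12 - \<epsilon>1) * (U1 + U1) \<le> 2 * \<bar>\<delta>12 - \<epsilon>1\<bar> * (U1 + U3)"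
      proof -
        have "(\<delta>12 - \<epsilon>1) * (U1 + U1) \<le> \<bar>\<delta>12 - \<epsilon>1\<bar> * (U1 + U1)"
          using U1 by (intro mult_right_mono) simp_all
        also have "\<dots> \<le> \<bar>\<delta>12 - \<epsilon>1\<bar> * (2 * (U1 + U3))"
          using U1 U3 by (intro mult_left_mono) simp_all
        finally show ?thesis by (simp only: mult.assoc mult.left_commute[of _ 2])
      qed
      moreover have "(\<mu>1 - \<epsilon>1) * D1 \<le> \<bar>\<mu>1 - \<epsilon>1\<bar> * D1"
        using D1 by (intro mult_right_mono) simp_all
      ultimately have "a \<le> 2 * \<bar>\<delta>12 - \<epsilon>1\<bar> * (U1 + U3) + \<bar>\<mu>1 - \<epsilon>1\<bar> * D1 - \<eta>1 * D2"
        using a(3) by linarith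
      then have A: "(1 + k) * a \<le> (1 + k) * (2 * \<bar>\<delta>12 - \<epsilon>1\<bar> * (U1 + U3) + \<bar>\<mu>1 - \<epsilon>1\<bar> * D1 - \<eta>1 * D2)"
        using k by (intro mult_left_mono) simp_all
      have "(\<delta>23 - \<epsilon>2) * (U1 + U3) \<le> \<bar>\<delta>23 - \<epsilon>2\<bar> * (U1 + U3)"
        using U1 U3 by (intro mult_right_mono) simp_all
      then have "b \<le> \<gamma>23 * V + \<bar>\<delta>23 - \<epsilon>2\<bar> * (U1 + U3) + (\<mu>2 - \<epsilon>2) * D2 - \<eta>2 * D3"
        using b(3) by linarith
      then have B: "(1 + 1/k) * b \<le> (1 + 1/k) * (\<gamma>23 * V + \<bar>\<delta>23 - \<epsilon>2\<bar> * (U1 + U3) + (\<mu>2 - \<epsilon>2) * D2 - \<eta>2 * D3)"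
        using k by (intro mult_left_mono) simp_all
      have C: "(1 + 1/k) * (\<mu>2 - \<epsilon>2) * D2 \<le> (1 + k) * \<eta>1 * D2"
        using k_\<eta>1 D2 by (intro mult_right_mono)
      define j where "j = 1 + 1/k"
      show ?thesis
        using A B C unfolding \<beta>_def \<nu>_def j_def[symmetric] by (simp add: algebra_simps)
    qed
    finally have "l2_norm_sq (\<lambda>t. output_at S1 t 0 0 u1 d1 - output_at S3 t 0 0 u3 d3)
        \<le> ereal ((1 + 1/k) * \<gamma>23) * l2_norm_sq (\<lambda>t. u1 t - u3 t)
          + ereal (\<beta> + 1 - 1) * l2_norm_sq (\<lambda>t. (u1 t, u3 t))
          + ereal (\<nu> + 1 - 1) * l2_norm_sq d1 - ereal ((1 + 1/k) * \<eta>2) * l2_norm_sq d3"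
      unfolding V(2) U13 D1(2) D3(2) by simp
    then show "\<exists>d3\<in>L2. l2_norm_sq (\<lambda>t. output_at S1 t 0 0 u1 d1 - output_at S3 t 0 0 u3 d3)
        \<le> ereal ((1 + 1/k) * \<gamma>23) * l2_norm_sq (\<lambda>t. u1 t - u3 t)
          + ereal (\<beta> + 1 - 1) * l2_norm_sq (\<lambda>t. (u1 t, u3 t))
          + ereal (\<nu> + 1 - 1) * l2_norm_sq d1 - ereal ((1 + 1/k) * \<eta>2) * l2_norm_sq d3"
      using d3 by (rule bexI[where x = d3])
  qed (use k \<nu> \<open>\<eta>2 > 0\<close> in \<open>simp_all add: add_pos_pos\<close>)
  moreover have "(1 + 1/k) * \<gamma>23 > 0" using k \<gamma>23 by (simp add: add_pos_pos)
  moreover have "\<beta> + 1 > 0" using \<beta> by simp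
  ultimately show ?thesis by blast
qed

theorem proposition1:
  shows "(\<forall>S :: ('n::finite, 'm::finite, 'q::finite, 'p::finite) linear_system.
            zero_asymptotically_stable S \<longrightarrow> (\<exists>\<gamma>>0. \<forall>\<delta>>0. similar \<gamma> \<delta> S S)) \<and>
         (\<forall>(S1 :: ('n1::finite, 'k::finite, 'q1::finite, 'r::finite) linear_system)
           (S2 :: ('n2::finite, 'k, 'q2::finite, 'r) linear_system)
           (S3 :: ('n3::finite, 'k, 'q3::finite, 'r) linear_system)
           \<gamma>12 \<delta>12 \<gamma>23 \<delta>23.
            zero_asymptotically_stable S1 \<longrightarrow>
            zero_asymptotically_stable S2 \<longrightarrow>
            zero_asymptotically_stable S3 \<longrightarrow>
            \<gamma>12 > 0 \<longrightarrow> \<delta>12 > 0 \<longrightarrow> \<gamma>23 > 0 \<longrightarrow> \<delta>23 > 0 \<longrightarrow>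
            similar \<gamma>12 \<delta>12 S1 S2 \<longrightarrow>
            similar \<gamma>23 \<delta>23 S2 S3 \<longrightarrow>
            (\<exists>\<gamma>13>0. \<exists>\<delta>13>0. similar \<gamma>13 \<delta>13 S1 S3))"
  using similar_self similar_trans by (intro conjI allI impI) assumption+

end
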